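(* Assume in addition $\mathbb E Y_0^3<\infty$ and $\mathbb E\varepsilon_1^3<\infty$. Then $\sqrt n(\tilde\alpha_n-\alpha)\to\mathcal N(0,\sigma_{\alpha,\varepsilon}^2)$ in distribution as $n\to\infty$. Moreover, conditionally on the value $Y_{s-1}$, $$\sqrt n\big(\tilde\theta_n-(Y_s-\alpha Y_{s-1}-\mu_\varepsilon)\big)\to\mathcal N(0,Y_{s-1}^2\sigma_{\alpha,\varepsilon}^2)$$ in distribution as $n\to\infty$.
   Context: Let $\alpha\in(0,1)$. Let $(\varepsilon_k)_{k\in\mathbb N}$ be i.i.d. non-negative integer-valued random variables with $\mathbb E\varepsilon_1^2<\infty$ and $\mathbb P(\varepsilon_1\ne 0)>0$; write $\mu_\varepsilon=\mathbb E\varepsilon_1$ (assumed known), $\sigma_\varepsilon^2=\operatorname{Var}\varepsilon_1$. For each $k\in\mathbb N$ let $(\xi_{k,j})_{j\in\mathbb N}$ be i.i.d. Bernoulli random variables with mean $\alpha$, these sequences being mutually independent and independent of $(\varepsilon_k)$. The INAR(1) Markov chain $X_k=\sum_{j=1}^{X_{k-1}}\xi_{k,j}+\varepsilon_k$ (with any independent initial value) has a unique stationary distribution; $\tilde X$ denotes a random variable with it, and $\sigma_{\alpha,\varepsilon}^2=\frac{\alpha(1-\alpha)\mathbb E\tilde X^3+\sigma_\varepsilon^2\mathbb E\tilde X^2}{(\mathbb E\tilde X^2)^2}$. Innovational outlier: fix a known time $s\in\mathbb N$ and size $\theta\in\mathbb N$. Let $Y_0$ be a non-negative integer-valued random variable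 independent of all $\xi_{k,j},\varepsilon_k$, and $Y_k=\sum_{j=1}^{Y_{k-1}}\xi_{k,j}+\varepsilon_k+\delta_{k,s}\theta$, $k\in\mathbb N$. Define $\tilde\alpha_n=\frac{\sum_{k=1,k\neq s}^n(Y_k-\mu_\varepsilon)Y_{k-1}}{\sum_{k=1,k\neq s}^nY_{k-1}^2}$ when the denominator is positive (and $0$ otherwise) and $\tilde\theta_n=Y_s-\tilde\alpha_nY_{s-1}-\mu_\varepsilon$; this is the conditional least squares estimator minimizing $\sum_{k=1,k\ne s}^n(Y_k-\alpha'Y_{k-1}-\mu_\varepsilon)^2+(Y_s-\alpha'Y_{s-1}-\mu_\varepsilon-\theta')^2$. Conditional convergence: for random variables $\zeta_n$ and a $\mathbb Z_+$-valued random variable $\eta$, "conditionally on the value $\eta$, $\zeta_n\to\mathcal N(0,v(\eta))$" means: for every $m$ with $\mathbb P(\eta=m)>0$, the conditional distribution of $\zeta_n$ given $\{\eta=m\}$ converges weakly to $\mathcal N(0,v(m))$ (a degenerate normal if $v(m)=0$). *)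

theory Defs
  imports "HOL-Probability.Probability"
begin

text \<open>Index type for the jointly independent family of primitive random variables:
  the innovations eps k (k >= 1), the Bernoulli thinning variables xi k j (k, j >= 1),
  and the initial value Y0.\<close>

datatype inar_idx = Eps nat | Xi nat nat | Init

definition inar_rv ::
  "(nat \<Rightarrow> nat \<Rightarrow> 'a \<Rightarrow> nat) \<Rightarrow> (nat \<Rightarrow> 'a \<Rightarrow> nat) \<Rightarrow> ('a \<Rightarrow> nat) \<Rightarrow> inar_idx \<Rightarrow> 'a \<Rightarrow> nat" where
  "inar_rv xi eps Y0 i = (case i of Eps k \<Rightarrow> eps k | Xi k j \<Rightarrow> xi k j | Init \<Rightarrow> Y0)"

definition inar_indices :: "inar_idx set" where
  "inar_indices = {Eps k | k. 1 \<le> k} \<union> {Xi k j | k j. 1 \<le> k \<and> 1 \<le> j} \<union> {Init}"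

primrec inar_Y ::
  "nat \<Rightarrow> nat \<Rightarrow> (nat \<Rightarrow> nat \<Rightarrow> 'a \<Rightarrow> nat) \<Rightarrow> (nat \<Rightarrow> 'a \<Rightarrow> nat) \<Rightarrow> ('a \<Rightarrow> nat) \<Rightarrow> nat \<Rightarrow> 'a \<Rightarrow> nat" where
  "inar_Y s \<theta> xi eps Y0 0 x = Y0 x"
| "inar_Y s \<theta> xi eps Y0 (Suc k) x =
     (\<Sum>j = 1..inar_Y s \<theta> xi eps Y0 k x. xi (Suc k) j x) + eps (Suc k) x + (if Suc k = s then \<theta> else 0)"

definition inar_step :: "real \<Rightarrow> nat pmf \<Rightarrow> nat \<Rightarrow> nat pmf" where
  "inar_step \<alpha> pe m = bind_pmf (binomial_pmf m \<alpha>) (\<lambda>b. map_pmf (\<lambda>e. b + e) pe)"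

definition inar_stationary :: "real \<Rightarrow> nat pmf \<Rightarrow> nat pmf \<Rightarrow> bool" where
  "inar_stationary \<alpha> pe \<pi> \<longleftrightarrow> bind_pmf \<pi> (inar_step \<alpha> pe) = \<pi>"

definition inar_stat_dist :: "real \<Rightarrow> nat pmf \<Rightarrow> nat pmf" where
  "inar_stat_dist \<alpha> pe = (THE \<pi>. inar_stationary \<alpha> pe \<pi>)"

definition inar_sigma2 :: "real \<Rightarrow> nat pmf \<Rightarrow> real" where
  "inar_sigma2 \<alpha> pe =
     (let \<pi> = inar_stat_dist \<alpha> pe;
          m2 = measure_pmf.expectation \<pi> (\<lambda>n. real n ^ 2);
          m3 = measure_pmf.expectation \<pi> (\<lambda>n. real n ^ 3);
          v = measure_pmf.variance pe real
      in (\<alpha> * (1 - \<alpha>) * m3 + v * m2) / m2 ^ 2)"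

text \<open>CLS estimators. Y is the observed path, mu the (known) innovation mean.\<close>

definition cls_alpha :: "nat \<Rightarrow> real \<Rightarrow> (nat \<Rightarrow> 'a \<Rightarrow> nat) \<Rightarrow> nat \<Rightarrow> 'a \<Rightarrow> real" where
  "cls_alpha s \<mu> Y n x =
     (let D = (\<Sum>k \<in> {1..n} - {s}. real (Y (k - 1) x) ^ 2);
          N = (\<Sum>k \<in> {1..n} - {s}. (real (Y k x) - \<mu>) * real (Y (k - 1) x))
      in if D > 0 then N / D else 0)"

definition cls_theta :: "nat \<Rightarrow> real \<Rightarrow> (nat \<Rightarrow> 'a \<Rightarrow> nat) \<Rightarrow> nat \<Rightarrow> 'a \<Rightarrow> real" where
  "cls_theta s \<mu> Y n x = real (Y s x) - cls_alpha s \<mu> Y n x * real (Y (s - 1) x) - \<mu>"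

definition normal_law :: "real \<Rightarrow> real measure" where
  "normal_law v = (if v = 0 then return borel 0 else density lborel (normal_density 0 (sqrt v)))"

end

theory Submission
  imports Defs
begin

text \<open>Let P be the transition operator of the chain. Since a step from y + 1 is a step from y plus an
  independent Bernoulli variable, the difference operator satisfies \<open>\<Delta> P = \<alpha> P \<Delta>\<close>. This makes P monotone
  and contracting, gives existence and uniqueness of the stationary law \<open>\<pi>\<close>, and shows that the chain
  started at y is stochastically dominated by y plus a \<open>\<pi>\<close>-distributed variable.

  After time s the chain is time-homogeneous, so the joint characteristic function at (u, v) of the score
  \<open>\<Sum> (Y\<^sub>k - \<alpha> Y\<^sub>k\<^sub>-\<^sub>1 - \<mu>) Y\<^sub>k\<^sub>-\<^sub>1 / sqrt n\<close> and the information \<open>\<Sum> Y\<^sub>k\<^sub>-\<^sub>1\<^sup>2 / n\<close> is governed by powers of a perturbation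
  Q of P. Because P preserves polynomials of degree at most 3, the Poisson equation with the right-hand
  side \<open>-u\<^sup>2 w/2 + i v y\<^sup>2\<close>, where w(y) is the conditional variance of a score increment, has an explicit cubic
  solution H. Then 1 + H/n is an eigenfunction of Q up to an error o(1/n) that, by the domination,
  is uniformly negligible along the chain (Nagaev's method), and the characteristic function converges to
  that of a Gaussian score and a constant information. Conditioning on the value at time s - 1 only
  changes the state from which this limit is started.\<close>

section \<open>The transition kernel and stochastic domination\<close>

text \<open>The obstacle is that only third moments are available. The conditional variance of a
  score increment from state y is already cubic in y, so third moments just make the limiting
  variance finite and leave no room for a Lyapunov condition. Accordingly n times the remainder of
  the eigenfunction equation tends to 0 at each state, but without a rate and bounded only by a
  multiple of 1 + y^3. Adding up n such remainders along the chain calls for uniform integrability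
  of the cubes; one law with finite third moment that dominates all times at once supplies it
  through dominated convergence. The parameter v is carried along because the estimation error is a
  ratio: with numerator and denominator treated jointly, no separate law of large numbers for the
  denominator enters.\<close>

lemma inar_step_0: "inar_step \<alpha> pe 0 = pe" if "0 < \<alpha>" "\<alpha> < 1"
  using that by (simp add: inar_step_def binomial_pmf_0 bind_return_pmf map_pmf_idI)

lemma inar_step_Suc:
  assumes "0 < \<alpha>" "\<alpha> < 1"
  shows "inar_step \<alpha> pe (Suc m) =
    bind_pmf (bernoulli_pmf \<alpha>) (\<lambda>b. map_pmf (\<lambda>y. of_bool b + y) (inar_step \<alpha> pe m))"
  using assms
  by (auto simp: inar_step_def binomial_pmf_Suc bind_assoc_pmf bind_return_pmf map_bind_pmf pmf.map_comp o_def
      add.assoc of_bool_def intro!: bind_pmf_cong map_pmf_cong)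

text \<open>Valued in \<open>ennreal\<close>, so that powers of the operator can be formed and
  compared without integrability conditions.\<close>

definition inar_op :: "real \<Rightarrow> nat pmf \<Rightarrow> (nat \<Rightarrow> ennreal) \<Rightarrow> nat \<Rightarrow> ennreal" where
  "inar_op \<alpha> pe f y = (\<integral>\<^sup>+z. f z \<partial>measure_pmf (inar_step \<alpha> pe y))"

lemma inar_op_Suc:
  assumes "0 < \<alpha>" "\<alpha> < 1"
  shows "inar_op \<alpha> pe f (Suc m) = 
    ennreal \<alpha> * inar_op \<alpha> pe (\<lambda>y. f (Suc y)) m + ennreal (1 - \<alpha>) * inar_op \<alpha> pe f m"
  using assms by (simp add: inar_op_def inar_step_Suc mult.commute)

lemma inar_op_mono: "(\<And>y. f y \<le> g y) \<Longrightarrow> inar_op \<alpha> pe f y \<le> inar_op \<alpha> pe g y"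
  by (simp add: inar_op_def nn_integral_mono)

lemma inar_op_add: "inar_op \<alpha> pe (\<lambda>y. f y + g y) = (\<lambda>y. inar_op \<alpha> pe f y + inar_op \<alpha> pe g y)"
  by (simp add: inar_op_def nn_integral_add fun_eq_iff)

lemma convex_combination_le_ennreal:
  fixes a b :: ennreal
  assumes "0 < p" "p < 1" "b \<le> a"
  shows "b \<le> ennreal p * a + ennreal (1 - p) * b" "ennreal p * a + ennreal (1 - p) * b \<le> a"
proof -
  have *: "ennreal p * c + ennreal (1 - p) * c = c" for c
    using assms by (simp add: distrib_right[symmetric] ennreal_plus[symmetric] del: ennreal_plus)
  have "ennreal p * b + ennreal (1 - p) * b \<le> ennreal p * a + ennreal (1 - p) * b"
    "ennreal p * a + ennreal (1 - p) * b \<le> ennreal p * a + ennreal (1 - p) * a"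
    using assms by (auto intro!: add_mono mult_left_mono)
  then show "b \<le> ennreal p * a + ennreal (1 - p) * b" "ennreal p * a + ennreal (1 - p) * b \<le> a"
    unfolding * by auto
qed

lemma mono_inar_op:
  assumes \<alpha>: "0 < \<alpha>" "\<alpha> < 1" and "mono f"
  shows "mono (inar_op \<alpha> pe f)"
proof (rule incseq_SucI)
  fix m
  have "inar_op \<alpha> pe f m \<le> inar_op \<alpha> pe (\<lambda>y. f (Suc y)) m"
    using \<open>mono f\<close> by (intro inar_op_mono) (auto intro: monoD)
  then show "inar_op \<alpha> pe f m \<le> inar_op \<alpha> pe f (Suc m)"
    unfolding inar_op_Suc[OF \<alpha>] by (rule convex_combination_le_ennreal[OF \<alpha>])
qed

text \<open>Coupling: of y extra individuals at most y survive the thinning, so a step from y + z is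
  dominated by y plus a step from z. Each induction step replaces one Bernoulli variable by
  1.\<close>

lemma inar_op_le_shift:
  assumes \<alpha>: "0 < \<alpha>" "\<alpha> < 1" and "mono f"
  shows "inar_op \<alpha> pe f (y + z) \<le> inar_op \<alpha> pe (\<lambda>z'. f (y + z')) z"
  using \<open>mono f\<close>
proof (induction y arbitrary: f)
  case (Suc y)
  have "inar_op \<alpha> pe f (y + z) \<le> inar_op \<alpha> pe (\<lambda>y. f (Suc y)) (y + z)"
    using Suc.prems by (intro inar_op_mono) (auto intro: monoD)
  then have "inar_op \<alpha> pe f (Suc (y + z)) \<le> inar_op \<alpha> pe (\<lambda>y. f (Suc y)) (y + z)"
    unfolding inar_op_Suc[OF \<alpha>] by (rule convex_combination_le_ennreal[OF \<alpha>])
  also have "\<dots> \<le> inar_op \<alpha> pe (\<lambda>z'. f (Suc (y + z'))) z"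
    using Suc.prems by (intro Suc.IH) (auto simp: mono_def)
  finally show ?case by simp
qed simp

lemma inar_op_stationary:
  "inar_stationary \<alpha> pe \<pi> \<Longrightarrow> (\<integral>\<^sup>+y. inar_op \<alpha> pe f y \<partial>measure_pmf \<pi>) = (\<integral>\<^sup>+y. f y \<partial>measure_pmf \<pi>)"
  unfolding inar_op_def nn_integral_bind_pmf[symmetric] by (simp add: inar_stationary_def)

text \<open>This domination replaces uniform integrability of the third powers along the chain.\<close>

lemma inar_op_funpow_le_stationary:
  assumes \<alpha>: "0 < \<alpha>" "\<alpha> < 1" and st: "inar_stationary \<alpha> pe \<pi>" and "mono f"
  shows "(inar_op \<alpha> pe ^^ j) f y \<le> (\<integral>\<^sup>+z. f (y + z) \<partial>measure_pmf \<pi>)"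
  using \<open>mono f\<close>
proof (induction j arbitrary: f)
  case 0
  have "f y \<le> (\<integral>\<^sup>+z. f y \<partial>measure_pmf \<pi>)" by (simp add: measure_pmf.emeasure_space_1)
  also have "\<dots> \<le> (\<integral>\<^sup>+z. f (y + z) \<partial>measure_pmf \<pi>)"
    using 0 by (intro nn_integral_mono) (auto intro: monoD)
  finally show ?case by simp
next
  case (Suc j)
  \<comment> \<open>Peeling the innermost application makes the induction act on f: the hypothesis
    is used for the monotone function P f, the shift is then moved out of P, and invariance absorbs
    the step.\<close>
  have "(inar_op \<alpha> pe ^^ Suc j) f y = (inar_op \<alpha> pe ^^ j) (inar_op \<alpha> pe f) y"
    by (simp add: funpow_swap1)
  also have "\<dots> \<le> (\<integral>\<^sup>+z. inar_op \<alpha> pe f (y + z) \<partial>measure_pmf \<pi>)"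
    by (rule Suc.IH[OF mono_inar_op[OF \<alpha> Suc.prems]])
  also have "\<dots> \<le> (\<integral>\<^sup>+z. inar_op \<alpha> pe (\<lambda>z'. f (y + z')) z \<partial>measure_pmf \<pi>)"
    by (intro nn_integral_mono inar_op_le_shift[OF \<alpha> Suc.prems])
  also have "\<dots> = (\<integral>\<^sup>+z. f (y + z) \<partial>measure_pmf \<pi>)"
    by (rule inar_op_stationary[OF st])
  finally show ?case .
qed

section \<open>The stationary distribution\<close>

lemma pmf_inar_step_Suc:
  assumes "0 < \<alpha>" "\<alpha> < 1"
  shows "pmf (inar_step \<alpha> pe (Suc m)) x =
    \<alpha> * pmf (map_pmf Suc (inar_step \<alpha> pe m)) x + (1 - \<alpha>) * pmf (inar_step \<alpha> pe m) x"
proof -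
  have "(+) (Suc 0) = Suc" by auto
  with assms show ?thesis by (simp add: inar_step_Suc pmf_bind mult.commute map_pmf_idI)
qed

lemma has_bochner_integral_measure_pmf:
  fixes f :: "'a::countable \<Rightarrow> 'b::{banach, second_countable_topology}"
  shows "has_bochner_integral (measure_pmf p) f c \<longleftrightarrow>
     has_bochner_integral (count_space UNIV) (\<lambda>x. pmf p x *\<^sub>R f x) c"
  unfolding measure_pmf_eq_density
  by (simp add: has_bochner_integral_iff integrable_density integral_density)

text \<open>The difference identity for signed and complex functions;
  \<open>has_bochner_integral\<close> transports integrability and value together.\<close>

lemma has_bochner_integral_inar_step_Suc:
  fixes f :: "nat \<Rightarrow> 'b::{banach, second_countable_topology}"
  assumes \<alpha>: "0 < \<alpha>" "\<alpha> < 1"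
    and "has_bochner_integral (inar_step \<alpha> pe m) f c"
    and "has_bochner_integral (inar_step \<alpha> pe m) (\<lambda>y. f (Suc y)) d"
  shows "has_bochner_integral (inar_step \<alpha> pe (Suc m)) f (\<alpha> *\<^sub>R d + (1 - \<alpha>) *\<^sub>R c)"
proof -
  have "has_bochner_integral (map_pmf Suc (inar_step \<alpha> pe m)) f d"
    using assms(4) unfolding map_pmf_rep_eq by (subst has_bochner_integral_distr) auto
  from this[unfolded has_bochner_integral_measure_pmf] assms(3)[unfolded has_bochner_integral_measure_pmf]
  show ?thesis
    unfolding has_bochner_integral_measure_pmf pmf_inar_step_Suc[OF \<alpha>] scaleR_add_left scaleR_scaleR[symmetric]
    by (intro has_bochner_integral_add has_bochner_integral_scaleR_right)
qed

lemma integrable_lower_power: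
  fixes p :: "nat pmf"
  assumes "integrable (measure_pmf p) (\<lambda>n. real n ^ m)" "k \<le> m"
  shows "integrable (measure_pmf p) (\<lambda>n. real n ^ k)"
proof (rule Bochner_Integration.integrable_bound[where f="\<lambda>n. 1 + real n ^ m"])
  show "AE n in p. norm (real n ^ k) \<le> norm (1 + real n ^ m)"
  proof (rule AE_I2)
    fix n show "norm (real n ^ k) \<le> norm (1 + real n ^ m)"
      using \<open>k \<le> m\<close> power_increasing[of k m "real n"] by (cases "n = 0") (auto simp: power_0_left)
  qed
qed (use assms in auto)

locale inar_chain =
  fixes \<alpha> :: real and pe :: "nat pmf"
  assumes \<alpha>: "0 < \<alpha>" "\<alpha> < 1"
    and integrable_cube: "integrable (measure_pmf pe) (\<lambda>n. real n ^ 3)"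
begin

section \<open>Conditional moments of one step\<close>

lemma integrable_pe: "k \<le> 3 \<Longrightarrow> integrable (measure_pmf pe) (\<lambda>n. real n ^ k)"
  by (rule integrable_lower_power[OF integrable_cube])

definition \<mu> :: real where "\<mu> = measure_pmf.expectation pe real"
definition \<mu>\<^sub>2 :: real where "\<mu>\<^sub>2 = measure_pmf.expectation pe (\<lambda>n. real n ^ 2)"
definition \<mu>\<^sub>3 :: real where "\<mu>\<^sub>3 = measure_pmf.expectation pe (\<lambda>n. real n ^ 3)"

lemma moments_nonneg: "0 \<le> \<mu>" "0 \<le> \<mu>\<^sub>2" "0 \<le> \<mu>\<^sub>3"
  by (auto simp: \<mu>_def \<mu>\<^sub>2_def \<mu>\<^sub>3_def)

text \<open>In \<open>c\<^sub>i\<^sub>j\<close> the first index is the power of the next state and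
  the second the power of the present state whose coefficient it is in the conditional
  moment.\<close>

definition c\<^sub>2\<^sub>1 :: real where "c\<^sub>2\<^sub>1 = \<alpha> * (1 - \<alpha>) + 2 * \<alpha> * \<mu>"
definition c\<^sub>3\<^sub>2 :: real where "c\<^sub>3\<^sub>2 = 3 * \<alpha>^2 * (1 - \<alpha>) + 3 * \<alpha>^2 * \<mu>"
definition c\<^sub>3\<^sub>1 :: real where
  "c\<^sub>3\<^sub>1 = 2 * \<alpha>^3 - 3 * \<alpha>^2 + \<alpha> + 3 * \<mu> * \<alpha> * (1 - \<alpha>) + 3 * \<alpha> * \<mu>\<^sub>2"

text \<open>One induction for all three, since expanding (y + 1)^3 in the step from m to m + 1 calls
  for the lower moments. The outcome is that P is triangular on monomials, with powers of \<alpha>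
  on the diagonal.\<close>

lemma step_moments:
  shows step_moment1: "has_bochner_integral (inar_step \<alpha> pe m) (\<lambda>y. real y) (\<alpha> * m + \<mu>)" (is "?P1 m")
    and step_moment2: "has_bochner_integral (inar_step \<alpha> pe m) (\<lambda>y. real y ^ 2) (\<alpha>^2 * real m^2 + c\<^sub>2\<^sub>1 * m + \<mu>\<^sub>2)" (is "?P2 m")
    and step_moment3: "has_bochner_integral (inar_step \<alpha> pe m) (\<lambda>y. real y ^ 3)
      (\<alpha>^3 * real m^3 + c\<^sub>3\<^sub>2 * real m^2 + c\<^sub>3\<^sub>1 * m + \<mu>\<^sub>3)" (is "?P3 m")
proof -
  have "?P1 m \<and> ?P2 m \<and> ?P3 m"
  proof (induction m)
    case 0
    show ?case
      using integrable_pe[of 1] integrable_pe[of 2] integrable_pe[of 3]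
      by (simp add: inar_step_0[OF \<alpha>] \<mu>_def \<mu>\<^sub>2_def \<mu>\<^sub>3_def has_bochner_integral_integrable)
  next
    case (Suc m)
    let ?I = "has_bochner_integral (measure_pmf (inar_step \<alpha> pe m))"
    note S = has_bochner_integral_inar_step_Suc[OF \<alpha>, where pe=pe and m=m]
    from Suc have 1: "?P1 m" and 2: "?P2 m" and 3: "?P3 m" by auto
    have 0: "?I (\<lambda>_. c) c" for c :: real
      by (simp add: has_bochner_integral_iff measure_pmf.prob_space[simplified])
    have "?I (\<lambda>y. real (Suc y)) ((\<alpha> * m + \<mu>) + 1)"
      using has_bochner_integral_add[OF 1 0[of 1]] by (simp add: add.commute)
    from S[OF 1 this] have P1: "?P1 (Suc m)" by (simp add: algebra_simps)
    have "?I (\<lambda>y. real (Suc y)^2) ((\<alpha>^2 * real m^2 + c\<^sub>2\<^sub>1 * m + \<mu>\<^sub>2) + 2 * (\<alpha> * m + \<mu>) + 1)"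
      using has_bochner_integral_add[OF has_bochner_integral_add[OF 2 has_bochner_integral_mult_right[OF 1, of 2]] 0[of 1]]
      by (simp add: power2_eq_square algebra_simps)
    from S[OF 2 this] have P2: "?P2 (Suc m)"
      by (simp add: c\<^sub>2\<^sub>1_def algebra_simps power2_eq_square)
    have "?I (\<lambda>y. real (Suc y)^3) ((\<alpha>^3 * real m^3 + c\<^sub>3\<^sub>2 * real m^2 + c\<^sub>3\<^sub>1 * m + \<mu>\<^sub>3)
       + 3 * (\<alpha>^2 * real m^2 + c\<^sub>2\<^sub>1 * m + \<mu>\<^sub>2) + 3 * (\<alpha> * m + \<mu>) + 1)"
      using has_bochner_integral_add[OF has_bochner_integral_add[OF has_bochner_integral_add[OF 3
         has_bochner_integral_mult_right[OF 2, of 3]] has_bochner_integral_mult_right[OF 1, of 3]] 0[of 1]]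
      by (simp add: power3_eq_cube power2_eq_square algebra_simps)
    from S[OF 3 this] have P3: "?P3 (Suc m)"
      by (simp add: c\<^sub>2\<^sub>1_def c\<^sub>3\<^sub>2_def c\<^sub>3\<^sub>1_def algebra_simps power2_eq_square power3_eq_cube)
    from P1 P2 P3 show ?case by blast
  qed
  then show "?P1 m" "?P2 m" "?P3 m" by auto
qed

section \<open>The n-step laws: contraction and drift\<close>

primrec law :: "nat \<Rightarrow> nat \<Rightarrow> nat pmf" where
  "law 0 y = return_pmf y"
| "law (Suc n) y = bind_pmf (inar_step \<alpha> pe y) (law n)"

lemma law_0_eq: "law 0 = return_pmf"
  by auto

text \<open>The recursion peels the first step, which suits contraction in the starting point; the
  moment drift and the limit in the invariance equation need the last step peeled instead.\<close>

lemma law_Suc': "law (Suc n) y = bind_pmf (law n y) (inar_step \<alpha> pe)"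
proof (induction n arbitrary: y)
  case (Suc n)
  have "law (Suc (Suc n)) y = bind_pmf (inar_step \<alpha> pe y) (\<lambda>z. bind_pmf (law n z) (inar_step \<alpha> pe))"
    unfolding law.simps(2)[of "Suc n"] using Suc by (metis (no_types, lifting) bind_pmf_cong)
  also have "\<dots> = bind_pmf (law (Suc n) y) (inar_step \<alpha> pe)"
    by (simp add: bind_assoc_pmf)
  finally show ?case .
qed (simp add: bind_return_pmf bind_return_pmf' law_0_eq)

lemma integrable_bounded_pmf:
  fixes f :: "nat \<Rightarrow> 'b::{banach, second_countable_topology}"
  shows "(\<And>x. norm (f x) \<le> B) \<Longrightarrow> integrable (measure_pmf p) f"
  by (rule measure_pmf.integrable_const_bound[where B=B]) auto

lemma step_contraction:
  fixes f :: "nat \<Rightarrow> real"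
  assumes f: "\<And>y. \<bar>f y\<bar> \<le> B" and L: "\<And>y. \<bar>f (Suc y) - f y\<bar> \<le> L"
  shows "\<bar>measure_pmf.expectation (inar_step \<alpha> pe (Suc y)) f - measure_pmf.expectation (inar_step \<alpha> pe y) f\<bar> \<le> \<alpha> * L"
proof -
  let ?E = "measure_pmf.expectation (inar_step \<alpha> pe y)"
  have i: "integrable (inar_step \<alpha> pe y) f" "integrable (inar_step \<alpha> pe y) (\<lambda>y. f (Suc y))"
    using f by (auto intro!: integrable_bounded_pmf[where B=B])
  have "measure_pmf.expectation (inar_step \<alpha> pe (Suc y)) f = \<alpha> * ?E (\<lambda>y. f (Suc y)) + (1 - \<alpha>) * ?E f"
    using has_bochner_integral_inar_step_Suc[OF \<alpha> has_bochner_integral_integrable[OF i(1)]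
      has_bochner_integral_integrable[OF i(2)]] by (simp add: has_bochner_integral_iff)
  then have "measure_pmf.expectation (inar_step \<alpha> pe (Suc y)) f - ?E f = \<alpha> * ?E (\<lambda>y. f (Suc y) - f y)"
    using i by (simp add: algebra_simps)
  moreover have "\<bar>?E (\<lambda>y. f (Suc y) - f y)\<bar> \<le> ?E (\<lambda>y. L)"
    by (intro order_trans[OF integral_abs_bound] integral_mono) (use i L in auto)
  ultimately show ?thesis
    using \<alpha> by (simp add: abs_mult)
qed

text \<open>As a function of the start, \<open>pmf (law n y) x\<close> is P^n applied to the
  indicator of x. The indicator has Lipschitz constant 1, each step multiplies the constant by
  \<alpha>, and y unit steps lead from 0 to y.\<close>

lemma law_contraction: "\<bar>pmf (law n y) x - pmf (law n 0) x\<bar> \<le> \<alpha> ^ n * y"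
proof -
  have *: "\<bar>pmf (law n (Suc y)) x - pmf (law n y) x\<bar> \<le> \<alpha> ^ n" for y
  proof (induction n arbitrary: y)
    case 0 then show ?case by (auto simp: indicator_def pmf_return)
  next
    case (Suc n)
    have "pmf (law n z) x \<le> 1" for z by (rule pmf_le_1)
    with Suc show ?case by (auto simp: pmf_bind intro!: step_contraction[where B=1])
  qed
  show ?thesis
  proof (induction y)
    case (Suc y)
    then show ?case using *[of y] by (simp add: algebra_simps abs_le_iff)
  qed simp
qed

text \<open>One more step averages over the first state z, of mean
  \<open>\<alpha> * y + \<mu>\<close>. The starts z and y are compared through 0; the term 2 y
  contains some slack.\<close>

lemma law_cauchy: "\<bar>pmf (law (Suc n) y) x - pmf (law n y) x\<bar> \<le> \<alpha> ^ n * ((\<alpha> + 2) * y + \<mu>)"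
proof -
  let ?E = "measure_pmf.expectation (inar_step \<alpha> pe y)"
  have i: "integrable (inar_step \<alpha> pe y) (\<lambda>z. pmf (law n z) x)"
    by (auto intro!: integrable_bounded_pmf[where B=1] pmf_le_1)
  have i1: "integrable (inar_step \<alpha> pe y) real" "?E real = \<alpha> * y + \<mu>"
    using step_moment1[of y] by (auto simp: has_bochner_integral_iff)
  have "\<bar>pmf (law (Suc n) y) x - pmf (law n y) x\<bar> = \<bar>?E (\<lambda>z. pmf (law n z) x - pmf (law n y) x)\<bar>"
    using i by (simp add: pmf_bind)
  also have "\<dots> \<le> ?E (\<lambda>z. \<alpha>^n * real z + 2 * \<alpha>^n * y)"
  proof (intro order_trans[OF integral_abs_bound] integral_mono)
    fix z
    have "0 \<le> \<alpha>^n * real y" using \<alpha> by simp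
    then show "\<bar>pmf (law n z) x - pmf (law n y) x\<bar> \<le> \<alpha>^n * real z + 2 * \<alpha>^n * y"
      using law_contraction[of n z x] law_contraction[of n y x] by (simp add: abs_le_iff)
  qed (use i i1 in auto)
  also have "\<dots> = \<alpha> ^ n * ((\<alpha> + 2) * y + \<mu>)"
    using i1 by (simp add: algebra_simps)
  finally show ?thesis .
qed

lemma law_convergent: "convergent (\<lambda>n. pmf (law n y) x)"
proof -
  have "summable (\<lambda>n. pmf (law (Suc n) y) x - pmf (law n y) x)"
  proof (rule summable_comparison_test')
    show "summable (\<lambda>n. \<alpha> ^ n * ((\<alpha> + 2) * y + \<mu>))"
      using \<alpha> by (intro summable_mult2 summable_geometric) auto
    show "norm (pmf (law (Suc n) y) x - pmf (law n y) x) \<le> \<alpha> ^ n * ((\<alpha> + 2) * y + \<mu>)" if "0 \<le> n" for n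
      using law_cauchy[of n y x] by simp
  qed
  then obtain l where "(\<lambda>n. \<Sum>i<n. pmf (law (Suc i) y) x - pmf (law i y) x) \<longlonglongrightarrow> l"
    by (auto simp: summable_def sums_def)
  then have "(\<lambda>n. pmf (law n y) x - pmf (law 0 y) x) \<longlonglongrightarrow> l"
    by (simp only: sum_lessThan_telescope[of "\<lambda>n. pmf (law n y) x"])
  from tendsto_add[OF this tendsto_const[of "pmf (law 0 y) x"]] show ?thesis
    by (auto simp: convergent_def)
qed

text \<open>A Foster-Lyapunov drift condition: the gap \<open>\<alpha> - \<alpha>^3\<close> in the
  leading coefficient absorbs the lower powers up to a constant.\<close>

lemma drift_cube: "\<exists>C\<ge>0. \<forall>y::nat. \<alpha>^3 * real y^3 + c\<^sub>3\<^sub>2 * real y^2 + c\<^sub>3\<^sub>1 * real y + \<mu>\<^sub>3 \<le> \<alpha> * real y^3 + C"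
proof -
  define D where "D = \<bar>c\<^sub>3\<^sub>2\<bar> + \<bar>c\<^sub>3\<^sub>1\<bar> + 1"
  \<comment> \<open>Makes D times \<delta> equal to this gap. D y^2 dominates the quadratic and
    linear terms, and y^2 <= \<delta> y^3 + 1/\<delta>^2 follows by comparing y with
    1/\<delta>.\<close>
  define \<delta> where "\<delta> = (\<alpha> - \<alpha>^3) / D"
  have D: "0 < D" by (simp add: D_def)
  have "\<alpha>^3 < \<alpha>^1" using \<alpha> by (intro power_strict_decreasing) auto
  then have \<delta>: "0 < \<delta>" using D by (simp add: \<delta>_def)
  have "\<alpha>^3 * real y^3 + c\<^sub>3\<^sub>2 * real y^2 + c\<^sub>3\<^sub>1 * real y + \<mu>\<^sub>3 \<le> \<alpha> * real y^3 + (D / \<delta>^2 + \<mu>\<^sub>3)" for y :: nat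
  proof -
    have "real y ^ 2 \<le> \<delta> * real y ^ 3 + 1 / \<delta>^2"
    proof (cases "\<delta> * y \<ge> 1")
      case True
      then have "1 * real y ^ 2 \<le> (\<delta> * y) * real y^2" by (intro mult_right_mono) auto
      then have "real y ^ 2 \<le> \<delta> * real y ^ 3" by (simp add: power2_eq_square power3_eq_cube mult_ac)
      moreover have "0 \<le> 1 / \<delta>^2" by simp
      ultimately show ?thesis by linarith
    next
      case False
      then have "real y < 1 / \<delta>" using \<delta> by (simp add: field_simps)
      then have "real y ^ 2 \<le> (1 / \<delta>)^2" by (intro power_mono) auto
      moreover have "0 \<le> \<delta> * real y ^ 3" using \<delta> by simp
      ultimately show ?thesis by (simp add: power_divide)
    qed
    then have "D * real y ^ 2 \<le> D * (\<delta> * real y ^ 3 + 1 / \<delta>^2)" using D by (intro mult_left_mono) auto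
    moreover have "D * (\<delta> * real y ^ 3 + 1 / \<delta>^2) = (\<alpha> - \<alpha>^3) * real y^3 + D / \<delta>^2"
      using D by (simp add: \<delta>_def field_simps)
    moreover have "c\<^sub>3\<^sub>2 * real y^2 + c\<^sub>3\<^sub>1 * y \<le> D * real y ^ 2"
    proof -
      have "real y \<le> real y ^ 2" by (cases y) (auto simp: power2_eq_square)
      then have "\<bar>c\<^sub>3\<^sub>1\<bar> * real y \<le> \<bar>c\<^sub>3\<^sub>1\<bar> * real y ^ 2" by (intro mult_left_mono) auto
      moreover have "c\<^sub>3\<^sub>1 * y \<le> \<bar>c\<^sub>3\<^sub>1\<bar> * real y" by (intro mult_right_mono) auto
      moreover have "c\<^sub>3\<^sub>2 * real y^2 \<le> \<bar>c\<^sub>3\<^sub>2\<bar> * real y^2" by (intro mult_right_mono) auto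
      moreover have "0 \<le> real y ^ 2" by simp
      ultimately show ?thesis unfolding D_def distrib_right mult_1 by linarith
    qed
    ultimately show ?thesis by (simp add: algebra_simps)
  qed
  then show ?thesis using D \<delta> moments_nonneg by (intro exI[of _ "D / \<delta>^2 + \<mu>\<^sub>3"]) auto
qed

lemma law_cube_bounded: "\<exists>B\<ge>0. \<forall>n. (\<integral>\<^sup>+y. ennreal (real y ^ 3) \<partial>measure_pmf (law n 0)) \<le> ennreal B"
proof -
  obtain C where C: "0 \<le> C" "\<And>y::nat. \<alpha>^3 * real y^3 + c\<^sub>3\<^sub>2 * real y^2 + c\<^sub>3\<^sub>1 * real y + \<mu>\<^sub>3 \<le> \<alpha> * real y^3 + C"
    using drift_cube by blast
  \<comment> \<open>The fixed point of B = \<alpha> B + C, so that the bound reproduces itself at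
    each step.\<close>
  define B where "B = C / (1 - \<alpha>)"
  have B: "0 \<le> B" "\<alpha> * B + C = B" using C \<alpha> by (auto simp: B_def field_simps)
  have "(\<integral>\<^sup>+y. ennreal (real y ^ 3) \<partial>measure_pmf (law n 0)) \<le> ennreal B" for n
  proof (induction n)
    case 0 then show ?case using B by simp
  next
    case (Suc n)
    have s: "(\<integral>\<^sup>+z. ennreal (real z ^ 3) \<partial>measure_pmf (inar_step \<alpha> pe y)) \<le> ennreal \<alpha> * ennreal (real y ^ 3) + ennreal C" for y
    proof -
      have "(\<integral>\<^sup>+z. ennreal (real z ^ 3) \<partial>measure_pmf (inar_step \<alpha> pe y)) =
        ennreal (\<alpha>^3 * real y^3 + c\<^sub>3\<^sub>2 * real y^2 + c\<^sub>3\<^sub>1 * real y + \<mu>\<^sub>3)"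
        using step_moment3[of y] by (subst nn_integral_eq_integral) (auto simp: has_bochner_integral_iff)
      also have "\<dots> \<le> ennreal (\<alpha> * real y^3 + C)" by (intro ennreal_leI C)
      also have "\<dots> = ennreal \<alpha> * ennreal (real y ^ 3) + ennreal C"
        using \<alpha> C by (simp add: ennreal_mult ennreal_plus)
      finally show ?thesis .
    qed
    have "(\<integral>\<^sup>+y. ennreal (real y ^ 3) \<partial>measure_pmf (law (Suc n) 0)) \<le>
       (\<integral>\<^sup>+y. ennreal \<alpha> * ennreal (real y ^ 3) + ennreal C \<partial>measure_pmf (law n 0))"
      unfolding law_Suc' nn_integral_bind_pmf by (intro nn_integral_mono s)
    also have "\<dots> = ennreal \<alpha> * (\<integral>\<^sup>+y. ennreal (real y ^ 3) \<partial>measure_pmf (law n 0)) + ennreal C"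
      by (simp add: nn_integral_add nn_integral_cmult measure_pmf.emeasure_space_1)
    also have "\<dots> \<le> ennreal \<alpha> * ennreal B + ennreal C"
      by (intro add_mono mult_left_mono Suc) auto
    also have "\<dots> = ennreal B"
      using \<alpha> B C by (simp add: ennreal_mult[symmetric] ennreal_plus[symmetric] del: ennreal_plus)
    finally show ?case .
  qed
  with B show ?thesis by auto
qed

lemma nn_integral_pmf_nat:
  "(\<integral>\<^sup>+y. f y \<partial>measure_pmf p) = (SUP K. \<Sum>y<K. ennreal (pmf p y) * f y)" for p :: "nat pmf"
  unfolding nn_integral_measure_pmf nn_integral_count_space_nat
  by (simp add: suminf_eq_SUP)

text \<open>The pointwise limits of the n-step probabilities are the candidate. Bounded third
  moments give tightness, so no mass escapes, and finite partial sums pass the moment bound to the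
  limit.\<close>

lemma ex_stationary:
  obtains \<pi> where "inar_stationary \<alpha> pe \<pi>" "integrable (measure_pmf \<pi>) (\<lambda>y. real y ^ 3)"
    "\<And>x y. (\<lambda>n. pmf (law n y) x) \<longlonglongrightarrow> pmf \<pi> x"
proof -
  define a where "a x = lim (\<lambda>n. pmf (law n 0) x)" for x
  have a0: "(\<lambda>n. pmf (law n 0) x) \<longlonglongrightarrow> a x" for x
    using law_convergent[of 0 x] by (simp add: a_def convergent_LIMSEQ_iff)
  have lim: "(\<lambda>n. pmf (law n y) x) \<longlonglongrightarrow> a x" for x y
  proof -
    have "(\<lambda>n. \<alpha>^n * real y) \<longlonglongrightarrow> 0 * real y" using \<alpha> by (intro tendsto_intros LIMSEQ_power_zero) auto
    then have "(\<lambda>n. \<alpha>^n * real y) \<longlonglongrightarrow> 0" by simp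
    then have "(\<lambda>n. pmf (law n y) x - pmf (law n 0) x) \<longlonglongrightarrow> 0"
      by (rule Lim_null_comparison[rotated]) (auto intro!: always_eventually law_contraction)
    from tendsto_add[OF this a0[of x]] show ?thesis by simp
  qed
  have a_nn: "0 \<le> a x" for x by (rule LIMSEQ_le_const[OF a0]) auto
  obtain B where B: "0 \<le> B" "\<And>n. (\<integral>\<^sup>+y. ennreal (real y ^ 3) \<partial>measure_pmf (law n 0)) \<le> ennreal B"
    using law_cube_bounded by auto
  have cube_fin: "(\<Sum>y<K. pmf (law n 0) y * real y ^ 3) \<le> B" for K n
  proof -
    have "(\<Sum>y<K. ennreal (pmf (law n 0) y) * ennreal (real y ^ 3)) \<le> ennreal B"
      using B(2)[of n] unfolding nn_integral_pmf_nat by (auto simp: SUP_le_iff)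
    then show ?thesis using B(1) by (simp add: ennreal_mult[symmetric] sum_nonneg)
  qed
  have a_cube: "(\<Sum>y<K. a y * real y ^ 3) \<le> B" for K
    by (rule LIMSEQ_le_const2[OF tendsto_sum[OF tendsto_mult[OF a0 tendsto_const]]]) (auto intro!: cube_fin)
  have sum_pmf: "(\<Sum>y<K. pmf p y) = measure (measure_pmf p) {..<K}" for K and p :: "nat pmf"
    by (subst measure_measure_pmf_finite) auto
  have a_le1: "(\<Sum>y<K. a y) \<le> 1" for K
    by (rule LIMSEQ_le_const2[OF tendsto_sum[OF a0]]) (auto simp: sum_pmf)
  have a_ge: "1 - B / K \<le> (\<Sum>y<K. a y)" if "0 < K" for K
  proof (rule LIMSEQ_le_const[OF tendsto_sum[OF a0]], intro exI allI impI)
    fix n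
    have i: "integrable (law n 0) (\<lambda>y. real y ^ 3)"
      using B(2)[of n] by (intro integrableI_nonneg) (auto simp: le_less_trans)
    \<comment> \<open>Markov's inequality for the cube; as y <= y^3 on integers, the mass outside
      \<open>{..<K}\<close> is at most B / K uniformly in n.\<close>
    have "measure (law n 0) {y \<in> space (law n 0). real K \<le> real y ^ 3} \<le> measure_pmf.expectation (law n 0) (\<lambda>y. real y ^ 3) / K"
      using that by (intro integral_Markov_inequality_measure[OF i, where A="{}"]) auto
    moreover have "measure_pmf.expectation (law n 0) (\<lambda>y. real y ^ 3) \<le> B"
      using B nn_integral_eq_integral[OF i] by (metis ennreal_le_iff zero_le_power of_nat_0_le_iff AE_I2)
    then have "measure_pmf.expectation (law n 0) (\<lambda>y. real y ^ 3) / K \<le> B / K"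
      by (simp add: divide_right_mono)
    moreover have "measure (law n 0) (- {..<K}) \<le> measure (law n 0) {y \<in> space (law n 0). real K \<le> real y ^ 3}"
    proof (intro measure_pmf.finite_measure_mono subsetI)
      fix y assume "y \<in> - {..<K}"
      then have "K \<le> y" by simp
      moreover have "real y \<le> real y ^ 3" by (cases y) (auto intro: self_le_power)
      ultimately show "y \<in> {y \<in> space (law n 0). real K \<le> real y ^ 3}" by simp
    qed auto
    ultimately have "measure (law n 0) (- {..<K}) \<le> B / K" by linarith
    then show "1 - B / K \<le> (\<Sum>y<K. pmf (law n 0) y)"
      using measure_pmf.prob_compl[of "{..<K}" "law n 0"] by (simp add: sum_pmf Compl_eq_Diff_UNIV)
  qed
  have "a sums 1"
    unfolding sums_def
  proof (rule tendsto_sandwich[OF _ _ _ tendsto_const])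
    show "\<forall>\<^sub>F K in sequentially. 1 - B / real K \<le> (\<Sum>y<K. a y)"
      using a_ge by (auto intro!: eventually_sequentiallyI[of 1])
    show "(\<lambda>K. 1 - B / real K) \<longlonglongrightarrow> 1"
      using tendsto_diff[OF tendsto_const[of 1] lim_const_over_n[of B]] by simp
  qed (simp add: a_le1)
  then have "(\<integral>\<^sup>+x. ennreal (a x) \<partial>count_space UNIV) = 1"
    by (simp add: nn_integral_count_space_nat suminf_ennreal_eq[OF a_nn])
  then have pmf: "pmf (embed_pmf a) x = a x" for x
    by (intro pmf_embed_pmf a_nn)
  define \<pi> where "\<pi> = embed_pmf a"
  \<comment> \<open>Truncating the sum over the present state and then letting n grow yields one
    inequality only, as in Fatou's lemma.\<close>
  have le: "pmf (bind_pmf \<pi> (inar_step \<alpha> pe)) x \<le> a x" for x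
  proof -
    have "ennreal (pmf (bind_pmf \<pi> (inar_step \<alpha> pe)) x) \<le> ennreal (a x)"
      unfolding ennreal_pmf_bind nn_integral_pmf_nat
    proof (rule SUP_least)
      fix K
      have "(\<Sum>y<K. pmf (law n 0) y * pmf (inar_step \<alpha> pe y) x) \<le> pmf (law (Suc n) 0) x" for n
      proof -
        have "ennreal (\<Sum>y<K. pmf (law n 0) y * pmf (inar_step \<alpha> pe y) x) \<le> ennreal (pmf (law (Suc n) 0) x)"
          unfolding law_Suc' ennreal_pmf_bind nn_integral_pmf_nat
          by (rule SUP_upper2[of K]) (auto simp: ennreal_mult[symmetric] sum_nonneg)
        then show ?thesis by simp
      qed
      then have "(\<Sum>y<K. a y * pmf (inar_step \<alpha> pe y) x) \<le> a x"
        by (intro LIMSEQ_le[OF tendsto_sum[OF tendsto_mult[OF a0 tendsto_const]] LIMSEQ_Suc[OF a0]]) auto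
      then show "(\<Sum>y<K. ennreal (pmf \<pi> y) * ennreal (pmf (inar_step \<alpha> pe y) x)) \<le> ennreal (a x)"
        by (simp add: \<pi>_def pmf ennreal_mult[symmetric] a_nn sum_nonneg)
    qed
    then show ?thesis using a_nn by simp
  qed
  have st: "inar_stationary \<alpha> pe \<pi>"
    unfolding inar_stationary_def
  \<comment> \<open>Both sides have total mass 1, so the inequality at every point leaves no room
    for a strict one.\<close>
  proof (rule ccontr)
    assume "bind_pmf \<pi> (inar_step \<alpha> pe) \<noteq> \<pi>"
    then obtain x where "pmf \<pi> x < pmf (bind_pmf \<pi> (inar_step \<alpha> pe)) x"
      using pmf_neq_exists_less[of \<pi>] by metis
    with le[of x] show False by (simp add: \<pi>_def pmf)
  qed
  have "(\<integral>\<^sup>+y. ennreal (real y ^ 3) \<partial>measure_pmf \<pi>) \<le> ennreal B"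
    unfolding nn_integral_pmf_nat
    by (intro SUP_least) (simp add: \<pi>_def pmf ennreal_mult[symmetric] a_nn sum_nonneg a_cube ennreal_leI)
  then have "integrable \<pi> (\<lambda>y. real y ^ 3)"
    by (intro integrableI_nonneg) (auto simp: le_less_trans)
  then show thesis
    using that[OF st] lim by (simp add: \<pi>_def pmf)
qed

lemma stationary_law: "inar_stationary \<alpha> pe \<pi> \<Longrightarrow> bind_pmf \<pi> (law n) = \<pi>"
proof (induction n)
  case (Suc n)
  then show ?case
    by (simp add: inar_stationary_def bind_assoc_pmf[symmetric])
qed (simp add: bind_return_pmf' law_0_eq)

text \<open>An invariant law is the mixture of the n-step laws over its own starting points; their
  limit is free of the start, and dominated convergence identifies the mixture with it.\<close>

lemma stationary_unique:
  assumes "inar_stationary \<alpha> pe \<pi>" and lim: "\<And>x y. (\<lambda>n. pmf (law n y) x) \<longlonglongrightarrow> a x"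
  shows "pmf \<pi> x = a x"
proof -
  have "(\<lambda>n. measure_pmf.expectation \<pi> (\<lambda>y. pmf (law n y) x)) \<longlonglongrightarrow> measure_pmf.expectation \<pi> (\<lambda>y. a x)"
    by (rule integral_dominated_convergence[where w="\<lambda>_. 1"]) (auto intro: lim pmf_le_1)
  moreover have "measure_pmf.expectation \<pi> (\<lambda>y. pmf (law n y) x) = pmf \<pi> x" for n
    unfolding pmf_bind[symmetric] using stationary_law[OF assms(1)] by simp
  ultimately show ?thesis by (auto dest: LIMSEQ_unique[OF tendsto_const])
qed

definition \<pi> :: "nat pmf" where "\<pi> = inar_stat_dist \<alpha> pe"

text \<open>Uniqueness resolves the definite description in \<open>inar_stat_dist\<close> to the law
  constructed above, third moment included.\<close>

lemma stationary_\<pi>: "inar_stationary \<alpha> pe \<pi>" and integrable_\<pi>_cube: "integrable (measure_pmf \<pi>) (\<lambda>y. real y ^ 3)"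
proof -
  obtain \<pi>' where *: "inar_stationary \<alpha> pe \<pi>'" "integrable (measure_pmf \<pi>') (\<lambda>y. real y ^ 3)"
    "\<And>x y. (\<lambda>n. pmf (law n y) x) \<longlonglongrightarrow> pmf \<pi>' x"
    using ex_stationary by blast
  have "\<pi> = \<pi>'"
    unfolding \<pi>_def inar_stat_dist_def
    using * by (intro the_equality) (auto intro!: pmf_eqI stationary_unique)
  with * show "inar_stationary \<alpha> pe \<pi>" "integrable (measure_pmf \<pi>) (\<lambda>y. real y ^ 3)" by auto
qed

lemma integrable_\<pi>: "k \<le> 3 \<Longrightarrow> integrable (measure_pmf \<pi>) (\<lambda>n. real n ^ k)"
  by (rule integrable_lower_power[OF integrable_\<pi>_cube])

section \<open>Moments of the stationary law and the limiting variance\<close>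

definition m\<^sub>1 :: real where "m\<^sub>1 = measure_pmf.expectation \<pi> real"
definition m\<^sub>2 :: real where "m\<^sub>2 = measure_pmf.expectation \<pi> (\<lambda>n. real n ^ 2)"
definition m\<^sub>3 :: real where "m\<^sub>3 = measure_pmf.expectation \<pi> (\<lambda>n. real n ^ 3)"
definition \<sigma>\<^sub>2 :: real where "\<sigma>\<^sub>2 = \<mu>\<^sub>2 - \<mu>^2"
text \<open>The \<open>\<pi>\<close>-mean of the conditional variance
  \<open>(\<alpha> * (1 - \<alpha>) * y + \<sigma>\<^sub>2) * y^2\<close> of a score
  increment.\<close>

definition V :: real where "V = \<alpha> * (1 - \<alpha>) * m\<^sub>3 + \<sigma>\<^sub>2 * m\<^sub>2"

lemma stationary_expectation:
  fixes f g :: "nat \<Rightarrow> real"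
  assumes f: "\<And>y. 0 \<le> f y" "\<And>y. has_bochner_integral (inar_step \<alpha> pe y) f (g y)"
    and i: "integrable (measure_pmf \<pi>) f" "integrable (measure_pmf \<pi>) g"
  shows "measure_pmf.expectation \<pi> f = measure_pmf.expectation \<pi> g"
proof -
  have fg: "measure_pmf.expectation (inar_step \<alpha> pe y) f = g y" "integrable (inar_step \<alpha> pe y) f" for y
    using f(2)[of y] by (simp_all add: has_bochner_integral_iff)
  have g: "0 \<le> g y" for y
    unfolding fg(1)[symmetric] by (intro Bochner_Integration.integral_nonneg f)
  have "ennreal (measure_pmf.expectation \<pi> f) = (\<integral>\<^sup>+y. ennreal (f y) \<partial>measure_pmf \<pi>)"
    by (rule nn_integral_eq_integral[symmetric]) (auto intro: i f)
  also have "\<dots> = (\<integral>\<^sup>+y. inar_op \<alpha> pe (\<lambda>y. ennreal (f y)) y \<partial>measure_pmf \<pi>)"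
    by (rule inar_op_stationary[OF stationary_\<pi>, symmetric])
  also have "\<dots> = (\<integral>\<^sup>+y. ennreal (g y) \<partial>measure_pmf \<pi>)"
  proof (rule nn_integral_cong)
    fix y show "inar_op \<alpha> pe (\<lambda>y. ennreal (f y)) y = ennreal (g y)"
      unfolding inar_op_def fg(1)[symmetric] by (rule nn_integral_eq_integral) (auto intro: fg f)
  qed
  also have "\<dots> = ennreal (measure_pmf.expectation \<pi> g)"
    by (rule nn_integral_eq_integral) (auto intro: i g)
  finally show ?thesis
    by (subst (asm) ennreal_inj) (auto intro!: Bochner_Integration.integral_nonneg f g)
qed

lemma stationary_moments:
  "m\<^sub>1 = \<alpha> * m\<^sub>1 + \<mu>"
  "m\<^sub>2 = \<alpha>^2 * m\<^sub>2 + c\<^sub>2\<^sub>1 * m\<^sub>1 + \<mu>\<^sub>2"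
  "m\<^sub>3 = \<alpha>^3 * m\<^sub>3 + c\<^sub>3\<^sub>2 * m\<^sub>2 + c\<^sub>3\<^sub>1 * m\<^sub>1 + \<mu>\<^sub>3"
proof -
  note i = integrable_\<pi>[of 1, simplified] integrable_\<pi>[of 2, simplified] integrable_\<pi>[of 3, simplified]
  have "m\<^sub>1 = measure_pmf.expectation \<pi> (\<lambda>y. \<alpha> * y + \<mu>)" unfolding m\<^sub>1_def
    by (rule stationary_expectation[OF _ step_moment1]) (use i in auto)
  also have "\<dots> = \<alpha> * m\<^sub>1 + \<mu>" using i by (simp add: m\<^sub>1_def)
  finally show "m\<^sub>1 = \<alpha> * m\<^sub>1 + \<mu>" .
  have "m\<^sub>2 = measure_pmf.expectation \<pi> (\<lambda>y. \<alpha>^2 * real y^2 + c\<^sub>2\<^sub>1 * y + \<mu>\<^sub>2)" unfolding m\<^sub>2_def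
    by (rule stationary_expectation[OF _ step_moment2]) (use i in auto)
  also have "\<dots> = \<alpha>^2 * m\<^sub>2 + c\<^sub>2\<^sub>1 * m\<^sub>1 + \<mu>\<^sub>2" using i by (simp add: m\<^sub>1_def m\<^sub>2_def)
  finally show "m\<^sub>2 = \<alpha>^2 * m\<^sub>2 + c\<^sub>2\<^sub>1 * m\<^sub>1 + \<mu>\<^sub>2" .
  have "m\<^sub>3 = measure_pmf.expectation \<pi> (\<lambda>y. \<alpha>^3 * real y^3 + c\<^sub>3\<^sub>2 * real y^2 + c\<^sub>3\<^sub>1 * y + \<mu>\<^sub>3)" unfolding m\<^sub>3_def
    by (rule stationary_expectation[OF _ step_moment3]) (use i in auto)
  also have "\<dots> = \<alpha>^3 * m\<^sub>3 + c\<^sub>3\<^sub>2 * m\<^sub>2 + c\<^sub>3\<^sub>1 * m\<^sub>1 + \<mu>\<^sub>3" using i by (simp add: m\<^sub>1_def m\<^sub>2_def m\<^sub>3_def)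
  finally show "m\<^sub>3 = \<alpha>^3 * m\<^sub>3 + c\<^sub>3\<^sub>2 * m\<^sub>2 + c\<^sub>3\<^sub>1 * m\<^sub>1 + \<mu>\<^sub>3" .
qed

lemma \<sigma>\<^sub>2_eq_variance: "measure_pmf.variance pe real = \<sigma>\<^sub>2"
  using integrable_pe[of 1] integrable_pe[of 2]
  by (subst measure_pmf.variance_eq) (auto simp: \<sigma>\<^sub>2_def \<mu>_def \<mu>\<^sub>2_def)

lemma \<sigma>\<^sub>2_nonneg: "0 \<le> \<sigma>\<^sub>2"
  unfolding \<sigma>\<^sub>2_eq_variance[symmetric] by (rule Bochner_Integration.integral_nonneg) simp

text \<open>An innovation that is not almost surely 0 has positive mean, so
  \<open>m\<^sub>1 = \<mu> / (1 - \<alpha>)\<close> is positive; y <= y^2 <= y^3 on integers passes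
  this on to the higher moments.\<close>

lemma stationary_moments_pos:
  assumes "measure_pmf.prob pe {n. n \<noteq> 0} > 0"
  shows "0 < m\<^sub>2" "0 < V"
proof -
  note i = integrable_\<pi>[of 1, simplified] integrable_\<pi>[of 2, simplified] integrable_\<pi>[of 3, simplified]
  have "\<mu> \<noteq> 0"
  proof
    assume "\<mu> = 0"
    then have "AE n in pe. real n = 0"
      unfolding \<mu>_def using integrable_pe[of 1] by (subst (asm) integral_nonneg_eq_0_iff_AE) auto
    then have "measure_pmf.prob pe {n. n \<noteq> 0} = 0"
      by (intro measure_pmf.prob_eq_0[THEN iffD2]) auto
    with assms show False by simp
  qed
  then have "0 < \<mu>" using moments_nonneg by simp
  moreover have "\<mu> = m\<^sub>1 * (1 - \<alpha>)" using stationary_moments(1) by (simp add: algebra_simps)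
  ultimately have "0 < m\<^sub>1" using \<alpha> by (simp add: zero_less_mult_iff)
  also have "m\<^sub>1 \<le> m\<^sub>2" unfolding m\<^sub>1_def m\<^sub>2_def
  proof (intro integral_mono)
    fix y show "real y \<le> real y ^ 2" by (cases "y = 0") (auto intro!: self_le_power)
  qed (use i in auto)
  finally show "0 < m\<^sub>2" .
  also have "m\<^sub>2 \<le> m\<^sub>3" unfolding m\<^sub>2_def m\<^sub>3_def
  proof (intro integral_mono)
    fix y show "real y ^ 2 \<le> real y ^ 3" by (cases "y = 0") (auto intro!: power_increasing)
  qed (use i in auto)
  finally have "0 < \<alpha> * (1 - \<alpha>) * m\<^sub>3" using \<alpha> by simp
  then show "0 < V" using \<sigma>\<^sub>2_nonneg \<open>0 < m\<^sub>2\<close> by (simp add: V_def add_pos_nonneg)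
qed

lemma inar_sigma2_eq: "inar_sigma2 \<alpha> pe = V / m\<^sub>2 ^ 2"
  unfolding inar_sigma2_def V_def m\<^sub>2_def m\<^sub>3_def \<pi>_def \<sigma>\<^sub>2_eq_variance Let_def by simp

section \<open>The Poisson equation for cubic polynomials\<close>

lemma cubic_bound:
  fixes y :: nat
  shows "\<bar>a * real y ^ 3 + b * real y ^ 2 + c * real y + d\<bar> \<le> (\<bar>a\<bar> + \<bar>b\<bar> + \<bar>c\<bar> + \<bar>d\<bar>) * (1 + real y ^ 3)"
proof -
  have *: "\<bar>e\<bar> * real y ^ k \<le> \<bar>e\<bar> * (1 + real y ^ 3)" if "k \<le> 3" for e k
    using that power_increasing[of k 3 "real y"]
    by (intro mult_left_mono) (cases "y = 0", auto simp: power_0_left)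
  show ?thesis
    using *[of 3 a] *[of 2 b] *[of 1 c] *[of 0 d] 
      abs_triangle_ineq[of "a * real y ^ 3 + b * real y ^ 2 + c * real y" d]
      abs_triangle_ineq[of "a * real y ^ 3 + b * real y ^ 2" "c * real y"]
      abs_triangle_ineq[of "a * real y ^ 3" "b * real y ^ 2"]
    unfolding abs_mult distrib_right[of _ _ "1 + real y ^ 3"] power_abs abs_of_nat power_0 power_one_right
    by linarith
qed

text \<open>P is triangular on monomials with diagonal entries below 1 except at constants, so H is
  found coefficient by coefficient from the top. The constant has to be the
  \<open>\<pi>\<close>-mean of a y^3 + b y^2, because H - P H has mean 0 under an invariant
  law.\<close>

lemma poisson_equation:
  obtains H :: "nat \<Rightarrow> real" and C where "\<And>y. \<bar>H y\<bar> \<le> C * (1 + real y ^ 3)"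
    "\<And>y. has_bochner_integral (inar_step \<alpha> pe y) H (H y + (a * m\<^sub>3 + b * m\<^sub>2) - (a * real y ^ 3 + b * real y ^ 2))"
proof -
  \<comment> \<open>From matching the coefficients of y^3, y^2 and y in this order; the constant
    term of H is free and set to 0.\<close>
  define h3 where "h3 = a / (1 - \<alpha>^3)"
  define h2 where "h2 = (b + h3 * c\<^sub>3\<^sub>2) / (1 - \<alpha>^2)"
  define h1 where "h1 = (h3 * c\<^sub>3\<^sub>1 + h2 * c\<^sub>2\<^sub>1) / (1 - \<alpha>)"
  have "\<alpha>^3 < 1" "\<alpha>^2 < 1" using \<alpha> by (simp_all add: power_less_one_iff)
  then have h: "h3 * (1 - \<alpha>^3) = a" "h2 * (1 - \<alpha>^2) = b + h3 * c\<^sub>3\<^sub>2" "h1 * (1 - \<alpha>) = h3 * c\<^sub>3\<^sub>1 + h2 * c\<^sub>2\<^sub>1"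
    using \<alpha> by (auto simp: h3_def h2_def h1_def)
  define H where "H y = h3 * real y ^ 3 + h2 * real y ^ 2 + h1 * real y + 0" for y
  have "h3 * \<mu>\<^sub>3 + h2 * \<mu>\<^sub>2 + h1 * \<mu> = a * m\<^sub>3 + b * m\<^sub>2"
  proof -
 \<comment> \<open>The stationary moment equations, solved for the innovation moments; the terms
   with \<open>m\<^sub>1\<close> then cancel by the choice of h1.\<close>
 have e: "\<mu> = (1 - \<alpha>) * m\<^sub>1" "\<mu>\<^sub>2 = (1 - \<alpha>^2) * m\<^sub>2 - c\<^sub>2\<^sub>1 * m\<^sub>1"
      "\<mu>\<^sub>3 = (1 - \<alpha>^3) * m\<^sub>3 - c\<^sub>3\<^sub>2 * m\<^sub>2 - c\<^sub>3\<^sub>1 * m\<^sub>1"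
      unfolding left_diff_distrib mult_1 using stationary_moments by linarith+
    have "h3 * \<mu>\<^sub>3 + h2 * \<mu>\<^sub>2 + h1 * \<mu> = (h3 * (1 - \<alpha>^3)) * m\<^sub>3 + (h2 * (1 - \<alpha>^2) - h3 * c\<^sub>3\<^sub>2) * m\<^sub>2
        + (h1 * (1 - \<alpha>) - (h3 * c\<^sub>3\<^sub>1 + h2 * c\<^sub>2\<^sub>1)) * m\<^sub>1"
      unfolding e by (simp add: algebra_simps)
    then show ?thesis unfolding h by simp
  qed
  moreover have "(\<alpha>^3 * real y^3 + c\<^sub>3\<^sub>2 * real y^2 + c\<^sub>3\<^sub>1 * real y + \<mu>\<^sub>3) * h3
      + (\<alpha>^2 * real y^2 + c\<^sub>2\<^sub>1 * real y + \<mu>\<^sub>2) * h2 + (\<alpha> * real y + \<mu>) * h1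
      = H y + (h3 * \<mu>\<^sub>3 + h2 * \<mu>\<^sub>2 + h1 * \<mu>) - (a * real y ^ 3 + b * real y ^ 2)" for y
  proof -
    have "(\<alpha>^3 * real y^3 + c\<^sub>3\<^sub>2 * real y^2 + c\<^sub>3\<^sub>1 * real y + \<mu>\<^sub>3) * h3
      + (\<alpha>^2 * real y^2 + c\<^sub>2\<^sub>1 * real y + \<mu>\<^sub>2) * h2 + (\<alpha> * real y + \<mu>) * h1
      = H y + (h3 * \<mu>\<^sub>3 + h2 * \<mu>\<^sub>2 + h1 * \<mu>) - ((h3 * (1 - \<alpha>^3)) * real y ^ 3 + (h2 * (1 - \<alpha>^2) - h3 * c\<^sub>3\<^sub>2) * real y ^ 2
        + (h1 * (1 - \<alpha>) - (h3 * c\<^sub>3\<^sub>1 + h2 * c\<^sub>2\<^sub>1)) * real y)"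
      by (simp add: H_def algebra_simps)
    then show ?thesis unfolding h by simp
  qed
  moreover have "has_bochner_integral (inar_step \<alpha> pe y) H
     ((\<alpha>^3 * real y^3 + c\<^sub>3\<^sub>2 * real y^2 + c\<^sub>3\<^sub>1 * real y + \<mu>\<^sub>3) * h3
      + (\<alpha>^2 * real y^2 + c\<^sub>2\<^sub>1 * real y + \<mu>\<^sub>2) * h2 + (\<alpha> * real y + \<mu>) * h1)" for y
    using has_bochner_integral_add[OF has_bochner_integral_add[OF
      has_bochner_integral_mult_left[OF step_moment3[of y], of h3]
      has_bochner_integral_mult_left[OF step_moment2[of y], of h2]]
      has_bochner_integral_mult_left[OF step_moment1[of y], of h1]]
    by (simp add: H_def[abs_def] mult.commute)
  ultimately show thesis
    using that[of H "\<bar>h3\<bar> + \<bar>h2\<bar> + \<bar>h1\<bar> + \<bar>0\<bar>"] cubic_bound[of h3 _ h2 h1 0] unfolding H_def by simp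
qed

lemma step_variance:
  "has_bochner_integral (inar_step \<alpha> pe y) (\<lambda>z. (real z - \<alpha> * y - \<mu>)^2) (\<alpha> * (1 - \<alpha>) * y + \<sigma>\<^sub>2)"
proof -
  have "has_bochner_integral (inar_step \<alpha> pe y) (\<lambda>z. real z ^ 2 - 2 * (\<alpha> * y + \<mu>) * real z + (\<alpha> * y + \<mu>)^2)
    ((\<alpha>^2 * real y^2 + c\<^sub>2\<^sub>1 * y + \<mu>\<^sub>2) - 2 * (\<alpha> * y + \<mu>) * (\<alpha> * y + \<mu>) + (\<alpha> * y + \<mu>)^2)"
    by (intro has_bochner_integral_add has_bochner_integral_diff has_bochner_integral_mult_right step_moment1 step_moment2)
      (simp add: has_bochner_integral_iff measure_pmf.prob_space[simplified])
  then show ?thesis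
    by (simp add: c\<^sub>2\<^sub>1_def \<sigma>\<^sub>2_def power2_eq_square algebra_simps)
qed

end

section \<open>Perturbation of the transition operator\<close>

lemma tendsto_exp_minus_one_scaled:
  fixes c :: complex
  shows "(\<lambda>n. of_nat n * (exp (c / of_nat n) - 1)) \<longlonglongrightarrow> c"
proof -
  have "((\<lambda>x. exp (x * c)) has_field_derivative c) (at 0)"
    by (auto intro!: derivative_eq_intros)
  then have d: "(\<lambda>h. (exp (h * c) - 1) / h) \<midarrow>0\<rightarrow> c"
    by (simp add: DERIV_def)
  have "filterlim (\<lambda>n. 1 / of_nat n :: complex) (at 0) sequentially"
    unfolding filterlim_at
    by (auto intro!: lim_const_over_n eventually_sequentiallyI[of 1])
  from filterlim_compose[OF d this] show ?thesis
    by (simp add: mult.commute)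
qed

text \<open>For a = p / sqrt n and b = q / n, n times the right-hand side is free of n. This
  supplies a dominating function that involves only the second power of the linear part.\<close>

lemma norm_iexp_add_bound:
  "norm (iexp (a + b) - 1 - \<i> * of_real a) \<le> a^2 / 2 + \<bar>b\<bar>"
proof -
  have a: "norm (iexp a - 1 - \<i> * of_real a) \<le> a^2 / 2"
    using iexp_approx1[of a 1] by (simp add: numeral_2_eq_2 diff_diff_eq power2_eq_square)
  have b: "norm (iexp a * (iexp b - 1)) \<le> \<bar>b\<bar>"
    using iexp_approx1[of b 0] by (simp add: norm_mult)
  have "iexp (a + b) - 1 - \<i> * of_real a = iexp a * (iexp b - 1) + (iexp a - 1 - \<i> * of_real a)"
    by (simp add: exp_add algebra_simps)
  then show ?thesis
    using norm_triangle_ineq[of "iexp a * (iexp b - 1)" "iexp a - 1 - \<i> * of_real a"] a b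
    by (simp only:)
qed

text \<open>For x = p / sqrt n + q / n, n x^2 = (p + q / sqrt n)^2 and n (x - p / sqrt n) = q
  exactly. So the second-order Taylor polynomial has the right limit, and the cubic remainder is of
  order 1 / sqrt n.\<close>

lemma tendsto_iexp_second_order:
  fixes p q :: real
  shows "(\<lambda>n. of_nat n * (iexp (p / sqrt n + q / n) - 1 - \<i> * of_real (p / sqrt n))) \<longlonglongrightarrow> Complex (- (p^2) / 2) q"
proof -
  have sq0: "(\<lambda>n. 1 / sqrt (real n)) \<longlonglongrightarrow> 0"
    using tendsto_real_sqrt[OF lim_const_over_n[of 1]] by (simp add: real_sqrt_divide)
  have main: "(\<lambda>n. of_real (- ((p + q * (1 / sqrt (real n)))^2) / 2) + \<i> * of_real q) \<longlonglongrightarrow> of_real (- ((p + q * 0)^2) / 2) + \<i> * of_real q"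
    by (intro tendsto_intros sq0) auto
  have err: "norm (of_nat n * (iexp (p / sqrt n + q / n) - 1 - \<i> * of_real (p / sqrt n))
       - (of_real (- ((p + q * (1 / sqrt (real n)))^2) / 2) + \<i> * of_real q))
      \<le> \<bar>p + q * (1 / sqrt (real n))\<bar>^3 / 6 * (1 / sqrt (real n))" if "0 < n" for n
  proof -
    define x where "x = p / sqrt n + q / n"
    define s where "s = sqrt (real n)"
    have s: "0 < s" "real n = s^2" using that by (auto simp: s_def)
    have x: "x = (p + q * (1 / s)) / s" using s by (simp add: x_def s_def[symmetric] field_simps power2_eq_square)
    have xs: "real n * x^2 = (p + q * (1 / s))^2" unfolding x s(2) using s(1) by (simp add: power_divide)
    have xp: "real n * (x - p / sqrt n) = q" using that by (simp add: x_def)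
    have "norm (iexp x - (1 + \<i> * of_real x - of_real (x^2) / 2)) \<le> \<bar>x\<bar>^3 / 6"
      using iexp_approx1[of x 2] by (simp add: numeral_2_eq_2 numeral_3_eq_3 power2_eq_square power_mult_distrib)
    then have "norm (of_nat n * (iexp x - (1 + \<i> * of_real x - of_real (x^2) / 2))) \<le> real n * (\<bar>x\<bar>^3 / 6)"
      unfolding norm_mult norm_of_nat by (rule mult_left_mono) simp
    moreover have "of_nat n * (iexp x - (1 + \<i> * of_real x - of_real (x^2) / 2))
       = of_nat n * (iexp x - 1 - \<i> * of_real (p / sqrt n)) - (of_real (- (real n * x^2) / 2) + \<i> * of_real (real n * (x - p / sqrt n)))"
      by (simp add: algebra_simps)
    moreover have "real n * (\<bar>x\<bar>^3 / 6) = \<bar>p + q * (1 / s)\<bar>^3 / 6 * (1 / s)"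
      unfolding x s(2) using s(1) by (simp add: abs_divide power_divide power2_eq_square power3_eq_cube mult_ac)
    ultimately show ?thesis unfolding xs xp by (simp add: x_def s_def)
  qed
  have "(\<lambda>n. of_nat n * (iexp (p / sqrt n + q / n) - 1 - \<i> * of_real (p / sqrt n))
       - (of_real (- ((p + q * (1 / sqrt (real n)))^2) / 2) + \<i> * of_real q)) \<longlonglongrightarrow> 0"
  proof (rule Lim_null_comparison)
    show "\<forall>\<^sub>F n in sequentially. norm (of_nat n * (iexp (p / sqrt n + q / n) - 1 - \<i> * of_real (p / sqrt n))
       - (of_real (- ((p + q * (1 / sqrt (real n)))^2) / 2) + \<i> * of_real q))
      \<le> \<bar>p + q * (1 / sqrt (real n))\<bar>^3 / 6 * (1 / sqrt (real n))"
      using err by (auto intro!: eventually_sequentiallyI[of 1])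
    have "(\<lambda>n. \<bar>p + q * (1 / sqrt (real n))\<bar>^3 / 6 * (1 / sqrt (real n))) \<longlonglongrightarrow> \<bar>p + q * 0\<bar>^3 / 6 * 0"
      by (intro tendsto_intros sq0) auto
    then show "(\<lambda>n. \<bar>p + q * (1 / sqrt (real n))\<bar>^3 / 6 * (1 / sqrt (real n))) \<longlonglongrightarrow> 0" by simp
  qed
  from tendsto_add[OF this main] show ?thesis
    by (simp add: Complex_eq)
qed

context inar_chain
begin

text \<open>The share of one transition from y to z in u times the score over sqrt n plus v times
  the information over n.\<close>

definition phase :: "real \<Rightarrow> real \<Rightarrow> nat \<Rightarrow> nat \<Rightarrow> nat \<Rightarrow> real" where
  "phase u v n y z = u / sqrt n * ((real z - \<alpha> * y - \<mu>) * y) + v / n * real y ^ 2"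

text \<open>The Fourier perturbation of P: its N-th power applied to 1 is the expectation of the
  exponential of N accumulated phases.\<close>

definition Q :: "real \<Rightarrow> real \<Rightarrow> nat \<Rightarrow> (nat \<Rightarrow> complex) \<Rightarrow> nat \<Rightarrow> complex" where
  "Q u v n f y = measure_pmf.expectation (inar_step \<alpha> pe y) (\<lambda>z. iexp (phase u v n y z) * f z)"

lemma norm_Q_le:
  assumes "\<And>z. norm (f z) \<le> B"
  shows "norm (Q u v n f y) \<le> B"
proof -
  have "norm (Q u v n f y) \<le> measure_pmf.expectation (inar_step \<alpha> pe y) (\<lambda>z. norm (iexp (phase u v n y z) * f z))"
    unfolding Q_def by (rule integral_norm_bound)
  also have "\<dots> \<le> measure_pmf.expectation (inar_step \<alpha> pe y) (\<lambda>z. B)"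
    using assms by (intro integral_mono integrable_bounded_pmf[where B=B]) (auto simp: norm_mult intro: order_trans[OF norm_ge_zero])
  finally show ?thesis by simp
qed

lemma norm_Q_funpow_le:
  "(\<And>z. norm (f z) \<le> B) \<Longrightarrow> norm ((Q u v n ^^ N) f y) \<le> B"
  by (induction N arbitrary: y) (auto intro!: norm_Q_le)

lemma inar_op_sum:
  "inar_op \<alpha> pe (\<lambda>y. \<Sum>j\<in>J. f j y) = (\<lambda>y. \<Sum>j\<in>J. inar_op \<alpha> pe (f j) y)"
  by (simp add: inar_op_def nn_integral_sum fun_eq_iff)

text \<open>Telescoping: Q^(N+1) 1 - l^(N+1) f = Q (Q^N 1 - l^N f) + l^N (Q f - l f). Phase factors
  have modulus 1, so |Q g| <= P |g|, and the defects Q f - l f accumulate along the unperturbed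
  chain, where domination applies.\<close>

lemma Q_funpow_approx:
  assumes f: "\<And>y. integrable (inar_step \<alpha> pe y) f" and l: "norm l \<le> 1"
  shows "ennreal (norm ((Q u v n ^^ N) (\<lambda>_. 1) y - l ^ N * f y)) \<le>
    (inar_op \<alpha> pe ^^ N) (\<lambda>y. ennreal (norm (1 - f y))) y +
    (\<Sum>j<N. (inar_op \<alpha> pe ^^ j) (\<lambda>y. ennreal (norm (Q u v n f y - l * f y))) y)"
proof (induction N arbitrary: y)
  case (Suc N)
  let ?g = "(Q u v n ^^ N) (\<lambda>_. 1)" and ?E = "measure_pmf.expectation (inar_step \<alpha> pe y)"
  let ?e = "\<lambda>z. iexp (phase u v n y z)" and ?P = "inar_op \<alpha> pe"
  let ?r = "\<lambda>y. ennreal (norm (Q u v n f y - l * f y))"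
  let ?h = "\<lambda>y. ennreal (norm (1 - f y))"
  have ig: "integrable (inar_step \<alpha> pe y) (\<lambda>z. ?e z * ?g z)"
    by (intro integrable_bounded_pmf[where B=1]) (simp add: norm_mult norm_Q_funpow_le)
  have jf: "integrable (inar_step \<alpha> pe y) (\<lambda>z. ?e z * f z)"
    using f[of y] by (rule Bochner_Integration.integrable_bound) (auto simp: norm_mult)
  have id: "integrable (inar_step \<alpha> pe y) (\<lambda>z. ?e z * (?g z - l ^ N * f z))"
    using Bochner_Integration.integrable_diff[OF ig integrable_mult_right[OF jf, of "l ^ N"]] by (simp add: algebra_simps)
  have "(Q u v n ^^ Suc N) (\<lambda>_. 1) y - l ^ Suc N * f y =
     ?E (\<lambda>z. ?e z * (?g z - l ^ N * f z)) + l ^ N * (Q u v n f y - l * f y)"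
  proof -
    have "?E (\<lambda>z. ?e z * (?g z - l ^ N * f z)) = ?E (\<lambda>z. ?e z * ?g z - l ^ N * (?e z * f z))"
      by (simp add: algebra_simps)
    also have "\<dots> = (Q u v n ^^ Suc N) (\<lambda>_. 1) y - l ^ N * Q u v n f y"
      using ig jf by (simp add: Q_def)
    finally show ?thesis by (simp add: algebra_simps)
  qed
  then have "norm ((Q u v n ^^ Suc N) (\<lambda>_. 1) y - l ^ Suc N * f y) \<le>
     norm (?E (\<lambda>z. ?e z * (?g z - l ^ N * f z))) + norm (l ^ N * (Q u v n f y - l * f y))"
    by (simp only: norm_triangle_ineq)
  also have "\<dots> \<le> norm (?E (\<lambda>z. ?e z * (?g z - l ^ N * f z))) + norm (Q u v n f y - l * f y)"
    using l by (intro add_left_mono) (simp add: norm_mult norm_power mult_left_le_one_le power_le_one)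
  finally have "ennreal (norm ((Q u v n ^^ Suc N) (\<lambda>_. 1) y - l ^ Suc N * f y)) \<le>
     ennreal (norm (?E (\<lambda>z. ?e z * (?g z - l ^ N * f z)))) + ?r y"
    by (simp add: ennreal_plus[symmetric] ennreal_leI del: ennreal_plus)
  also have "ennreal (norm (?E (\<lambda>z. ?e z * (?g z - l ^ N * f z)))) \<le> ?P (\<lambda>z. ennreal (norm (?g z - l ^ N * f z))) y"
    using integral_norm_bound_ennreal[OF id] by (simp add: inar_op_def norm_mult)
  also have "\<dots> \<le> ?P (\<lambda>z. (?P ^^ N) ?h z + (\<Sum>j<N. (?P ^^ j) ?r z)) y"
    by (intro inar_op_mono Suc.IH)
  also have "\<dots> = (?P ^^ Suc N) ?h y + (\<Sum>j<N. (?P ^^ Suc j) ?r y)"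
    by (simp add: inar_op_add inar_op_sum)
  finally show ?case
    by (simp add: sum.lessThan_Suc_shift add_ac del: sum.lessThan_Suc)
qed simp


lemma inar_op_funpow_mono:
  assumes "\<And>y. f y \<le> g y"
  shows "(inar_op \<alpha> pe ^^ j) f y \<le> (inar_op \<alpha> pe ^^ j) g y"
  by (induction j arbitrary: y) (auto intro: assms inar_op_mono)

lemma inar_op_funpow_le_expectation:
  assumes "mono f" "\<And>y. 0 \<le> f y" "integrable (measure_pmf \<pi>) (\<lambda>z. f (y + z))" "\<And>y. g y \<le> f y"
  shows "(inar_op \<alpha> pe ^^ j) (\<lambda>y. ennreal (g y)) y \<le> ennreal (measure_pmf.expectation \<pi> (\<lambda>z. f (y + z)))"
proof -
  have "(inar_op \<alpha> pe ^^ j) (\<lambda>y. ennreal (g y)) y \<le> (inar_op \<alpha> pe ^^ j) (\<lambda>y. ennreal (f y)) y"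
    using assms by (intro inar_op_funpow_mono ennreal_leI)
  also have "\<dots> \<le> (\<integral>\<^sup>+z. ennreal (f (y + z)) \<partial>measure_pmf \<pi>)"
    using assms(1) by (intro inar_op_funpow_le_stationary[OF \<alpha> stationary_\<pi>]) (auto simp: mono_def intro: ennreal_leI)
  also have "\<dots> = ennreal (measure_pmf.expectation \<pi> (\<lambda>z. f (y + z)))"
    using assms by (intro nn_integral_eq_integral) auto
  finally show ?thesis .
qed

lemma integrable_\<pi>_shifted_cube: "integrable (measure_pmf \<pi>) (\<lambda>z. c * (1 + real (y + z) ^ 3))"
proof -
  have "integrable (measure_pmf \<pi>) (\<lambda>z. c * (1 + (real y ^ 3 + (3 * real y ^ 2) * real z + (3 * real y) * real z ^ 2 + real z ^ 3)))"
    using integrable_\<pi>[of 1] integrable_\<pi>[of 2] integrable_\<pi>[of 3] by auto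
  then show ?thesis by (simp add: power3_eq_cube power2_eq_square algebra_simps)
qed

end

text \<open>The least increasing majorant of r. Domination by \<open>\<pi>\<close> is available for
  increasing functions; this majorant inherits increasing bounds and, being a maximum of finitely
  many values at each state, also convergence to 0.\<close>

primrec running_max :: "(nat \<Rightarrow> real) \<Rightarrow> nat \<Rightarrow> real" where
  "running_max r 0 = r 0"
| "running_max r (Suc y) = max (running_max r y) (r (Suc y))"

lemma mono_running_max: "mono (running_max r)"
  by (rule incseq_SucI) simp

lemma le_running_max: "r y \<le> running_max r y"
  by (cases y) auto

lemma running_max_le: "mono b \<Longrightarrow> (\<And>y. r y \<le> b y) \<Longrightarrow> running_max r y \<le> b y"
  by (induction y) (auto intro: order_trans[OF _ incseq_SucD])

lemma tendsto_running_max: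
  "(\<And>y. ((\<lambda>n. r n y) \<longlongrightarrow> 0) F) \<Longrightarrow> ((\<lambda>n. running_max (r n) y) \<longlongrightarrow> 0) F"
proof (induction y)
  case (Suc y)
  from tendsto_max[OF Suc.IH[OF Suc.prems] Suc.prems[of "Suc y"]] show ?case by simp
qed simp

context inar_chain
begin

text \<open>The solution H of the Poisson equation corrects the constant function 1 to an approximate
  eigenfunction 1 + H/n of Q, with eigenvalue exp (k/n).\<close>

lemma Q_funpow_limit:
  "(\<lambda>n. (Q u v n ^^ (n - s)) (\<lambda>_. 1) y) \<longlonglongrightarrow> exp (Complex (- (u^2 * V / 2)) (v * m\<^sub>2))"
proof -
  \<comment> \<open>a y^3 + b y^2 is -u^2/2 times the conditional variance of the score increment,
    and v y^2 belongs to the information. These real and imaginary parts of the right-hand side are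
    solved for separately.\<close>
  define a where "a = - (u^2 * \<alpha> * (1 - \<alpha>) / 2)"
  define b where "b = - (u^2 * \<sigma>\<^sub>2 / 2)"
  obtain H1 C1 where H1: "\<And>y. \<bar>H1 y\<bar> \<le> C1 * (1 + real y ^ 3)"
    "\<And>y. has_bochner_integral (inar_step \<alpha> pe y) H1 (H1 y + (a * m\<^sub>3 + b * m\<^sub>2) - (a * real y ^ 3 + b * real y ^ 2))"
    by (rule poisson_equation[where a=a and b=b]) (rule that)
  obtain H2 C2 where H2: "\<And>y. \<bar>H2 y\<bar> \<le> C2 * (1 + real y ^ 3)"
    "\<And>y. has_bochner_integral (inar_step \<alpha> pe y) H2 (H2 y + (0 * m\<^sub>3 + v * m\<^sub>2) - (0 * real y ^ 3 + v * real y ^ 2))"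
    by (rule poisson_equation[where a=0 and b=v]) (rule that)
  define C where "C = C1 + C2"
  define H where "H y = complex_of_real (H1 y) + \<i> * complex_of_real (H2 y)" for y
  \<comment> \<open>The \<open>\<pi>\<close>-mean of \<kappa>; its nonpositive real part keeps the
    eigenvalue \<open>l n\<close> in the unit disc.\<close>
  define k where "k = Complex (- (u^2 * V / 2)) (v * m\<^sub>2)"
  define \<kappa> where "\<kappa> y = complex_of_real (a * real y ^ 3 + b * real y ^ 2) + \<i> * complex_of_real (v * real y ^ 2)" for y :: nat
  have hb_complex: "has_bochner_integral (inar_step \<alpha> pe y) (\<lambda>z. complex_of_real (g z) + \<i> * complex_of_real (h z))
      (complex_of_real c + \<i> * complex_of_real d)"
    if "has_bochner_integral (inar_step \<alpha> pe y) g c" "has_bochner_integral (inar_step \<alpha> pe y) h d" for g h c d y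
    by (intro has_bochner_integral_add has_bochner_integral_mult_right has_bochner_integral_of_real that)
  have k_eq: "k = complex_of_real (a * m\<^sub>3 + b * m\<^sub>2) + \<i> * complex_of_real (v * m\<^sub>2)"
    by (simp add: k_def Complex_eq a_def b_def V_def field_simps)
  have H: "has_bochner_integral (inar_step \<alpha> pe y) H (H y + k - \<kappa> y)" for y
    using hb_complex[OF H1(2) H2(2), of y] by (simp add: H_def[abs_def] k_eq \<kappa>_def algebra_simps)
  have H_bound: "norm (H y) \<le> C * (1 + real y ^ 3)" for y
  proof -
    have "norm (H y) \<le> \<bar>H1 y\<bar> + \<bar>H2 y\<bar>"
      unfolding H_def by (rule order_trans[OF norm_triangle_ineq]) (simp add: norm_mult)
    then show ?thesis using H1(1)[of y] H2(1)[of y] by (simp add: C_def distrib_right)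
  qed
  have C: "0 \<le> C" using order_trans[OF norm_ge_zero H_bound[of 0]] by simp
  define f where "f n y = 1 + H y / of_nat n" for n y
  define l where "l n = exp (k / of_nat n)" for n :: nat
  have V: "0 \<le> V"
    unfolding V_def m\<^sub>2_def m\<^sub>3_def using \<alpha> \<sigma>\<^sub>2_nonneg by simp
  have l: "norm (l n) \<le> 1" for n
    using V by (simp add: l_def k_def)
  have l_lim: "(\<lambda>n. of_nat n * (l n - 1)) \<longlonglongrightarrow> k"
    unfolding l_def by (rule tendsto_exp_minus_one_scaled)
  then obtain K where K: "\<And>n. norm (of_nat n * (l n - 1)) \<le> K"
    using convergent_imp_Bseq[of "\<lambda>n. of_nat n * (l n - 1)"] by (auto simp: convergent_def Bseq_def)
  have kn: "(\<lambda>n. k / of_nat n) \<longlonglongrightarrow> 0" by (rule lim_const_over_n)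
  have l1: "l \<longlonglongrightarrow> 1" unfolding l_def[abs_def] using tendsto_exp[OF kn] by simp
  define R where "R n y = Q u v n (f n) y - l n * f n y" for n y
  define p where "p y z = u * ((real z - \<alpha> * y - \<mu>) * y)" for y z :: nat
  define q where "q y = v * real y ^ 2" for y :: nat
  have phase: "phase u v n y z = p y z / sqrt n + q y / n" for n y z
    by (simp add: phase_def p_def q_def)
  \<comment> \<open>For n > 0 this is n times (phase factor times \<open>f n z\<close>, minus 1,
    minus i p / sqrt n). The linear term would grow like sqrt n; it can be subtracted because
    \<open>p y\<close> is centred.\<close>
  define g where "g n y z = of_nat n * (iexp (phase u v n y z) - 1 - \<i> * of_real (p y z / sqrt n))
     + iexp (phase u v n y z) * H z" for n y z
  have p1: "has_bochner_integral (inar_step \<alpha> pe y) (p y) 0" for y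
  proof -
    have "has_bochner_integral (inar_step \<alpha> pe y) (\<lambda>z. u * y * real z - u * y * (\<alpha> * y + \<mu>)) (u * y * (\<alpha> * y + \<mu>) - u * y * (\<alpha> * y + \<mu>))"
      by (intro has_bochner_integral_diff has_bochner_integral_mult_right step_moment1)
         (simp add: has_bochner_integral_iff measure_pmf.prob_space[simplified])
    then show ?thesis by (simp add: p_def[abs_def] algebra_simps)
  qed
  have p2: "has_bochner_integral (inar_step \<alpha> pe y) (\<lambda>z. p y z ^ 2 / 2) (- (a * real y ^ 3 + b * real y ^ 2))" for y
  proof -
    have "p y z ^ 2 / 2 = (u^2 * real y ^ 2 / 2) * (real z - \<alpha> * y - \<mu>)^2" for z
      by (simp add: p_def power_mult_distrib)
    moreover have "- (a * real y ^ 3 + b * real y ^ 2) = (u^2 * real y ^ 2 / 2) * (\<alpha> * (1 - \<alpha>) * y + \<sigma>\<^sub>2)"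
      by (simp add: a_def b_def field_simps power2_eq_square power3_eq_cube)
    ultimately show ?thesis
      by (simp only: has_bochner_integral_mult_right[OF step_variance])
  qed
  have hc: "has_bochner_integral (inar_step \<alpha> pe y) (\<lambda>z. c) c" for c :: real and y
    by (simp add: has_bochner_integral_iff measure_pmf.prob_space[simplified])
  \<comment> \<open>A majorant of g free of n, with mean W. As W is again cubic, n times the
    remainder R has a bound D (1 + y^3) for all n.\<close>
  define w where "w y z = p y z ^ 2 / 2 + \<bar>q y\<bar> + C * (1 + real z ^ 3)" for y z :: nat
  define W where "W y = - (a * real y ^ 3 + b * real y ^ 2) + \<bar>q y\<bar> + C * (1 + (\<alpha>^3 * real y^3 + c\<^sub>3\<^sub>2 * real y^2 + c\<^sub>3\<^sub>1 * real y + \<mu>\<^sub>3))" for y :: nat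
  have w: "has_bochner_integral (inar_step \<alpha> pe y) (w y) (W y)" for y
    unfolding w_def[abs_def] W_def
    by (intro has_bochner_integral_add has_bochner_integral_mult_right p2 hc step_moment3)
  have g_bound: "norm (g n y z) \<le> w y z" for n y z
  proof (cases "n = 0")
    case True
    have "norm (g n y z) = norm (H z)" using True by (simp add: g_def norm_mult)
    moreover have "0 \<le> (p y z)^2 / 2" by simp
    ultimately show ?thesis using H_bound[of z] abs_ge_zero[of "q y"] unfolding w_def by linarith
  next
    case False
    have "norm (of_nat n * (iexp (phase u v n y z) - 1 - \<i> * of_real (p y z / sqrt n))) \<le>
        real n * ((p y z / sqrt n)^2 / 2 + \<bar>q y / n\<bar>)"
      unfolding norm_mult norm_of_nat phase by (intro mult_left_mono norm_iexp_add_bound) simp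
    also have "\<dots> = p y z ^ 2 / 2 + \<bar>q y\<bar>"
      using False by (simp add: power_divide field_simps abs_divide)
    finally have 1: "norm (of_nat n * (iexp (phase u v n y z) - 1 - \<i> * of_real (p y z / sqrt n))) \<le> p y z ^ 2 / 2 + \<bar>q y\<bar>" .
    have 2: "norm (iexp (phase u v n y z) * H z) \<le> C * (1 + real z ^ 3)"
      using H_bound[of z] by (simp add: norm_mult)
    show ?thesis unfolding g_def w_def by (rule order_trans[OF norm_triangle_ineq add_mono[OF 1 2]])
  qed
  have f_int: "integrable (inar_step \<alpha> pe y) (f n)" for n y
    unfolding f_def[abs_def] using H[of y] by (auto simp: has_bochner_integral_iff)
  have e_int: "integrable (inar_step \<alpha> pe y) (\<lambda>z. iexp (phase u v n y z) * f n z)" for n y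
    using f_int[of y n] by (rule Bochner_Integration.integrable_bound) (auto simp: norm_mult)
  have R_eq: "of_nat n * R n y = measure_pmf.expectation (inar_step \<alpha> pe y) (g n y) - of_nat n * (l n - 1) - l n * H y"
    if n: "0 < n" for n y
  proof -
    have g_eq: "g n y = (\<lambda>z. of_nat n * (iexp (phase u v n y z) * f n z) - (of_nat n + (\<i> * of_nat n / sqrt n) * of_real (p y z)))"
      using n by (simp add: fun_eq_iff g_def f_def field_simps)
    have "has_bochner_integral (inar_step \<alpha> pe y) (\<lambda>z. of_nat n * (iexp (phase u v n y z) * f n z) - (of_nat n + (\<i> * of_nat n / sqrt n) * complex_of_real (p y z)))
       (of_nat n * Q u v n (f n) y - (of_nat n + (\<i> * of_nat n / sqrt n) * complex_of_real 0))"
    proof (intro has_bochner_integral_diff has_bochner_integral_add has_bochner_integral_mult_right has_bochner_integral_of_real p1)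
      show "has_bochner_integral (inar_step \<alpha> pe y) (\<lambda>z. iexp (phase u v n y z) * f n z) (Q u v n (f n) y)"
        unfolding Q_def by (rule has_bochner_integral_integrable[OF e_int])
    qed (simp add: has_bochner_integral_iff measure_pmf.prob_space[simplified])
    then have "measure_pmf.expectation (inar_step \<alpha> pe y) (g n y) = of_nat n * Q u v n (f n) y - of_nat n"
      unfolding g_eq by (simp add: has_bochner_integral_iff)
    then show ?thesis using n by (simp add: R_def f_def field_simps)
  qed
  have R_lim: "(\<lambda>n. of_nat n * R n y) \<longlonglongrightarrow> 0" for y
  proof -
    have "(\<lambda>n. measure_pmf.expectation (inar_step \<alpha> pe y) (g n y)) \<longlonglongrightarrow>
       measure_pmf.expectation (inar_step \<alpha> pe y) (\<lambda>z. Complex (- (p y z ^ 2) / 2) (q y) + 1 * H z)"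
    proof (rule integral_dominated_convergence[where w="w y"])
      show "integrable (inar_step \<alpha> pe y) (w y)" using w[of y] by (simp add: has_bochner_integral_iff)
      have "(\<lambda>n. g n y z) \<longlonglongrightarrow> Complex (- (p y z ^ 2) / 2) (q y) + 1 * H z" for z
        unfolding g_def
      proof (intro tendsto_add tendsto_mult tendsto_const)
        show "(\<lambda>n. of_nat n * (iexp (phase u v n y z) - 1 - \<i> * of_real (p y z / sqrt n))) \<longlonglongrightarrow> Complex (- (p y z ^ 2) / 2) (q y)"
          unfolding phase by (rule tendsto_iexp_second_order)
        have "(\<lambda>n. p y z / sqrt (real n) + q y / real n) \<longlonglongrightarrow> 0 + 0"
          by (intro tendsto_add lim_const_over_n tendsto_divide_0[OF tendsto_const]
              filterlim_at_top_imp_at_infinity filterlim_compose[OF sqrt_at_top filterlim_real_sequentially])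
        then have "(\<lambda>n. \<i> * complex_of_real (p y z / sqrt (real n) + q y / real n)) \<longlonglongrightarrow> \<i> * complex_of_real (0 + 0)"
          by (intro tendsto_mult tendsto_const tendsto_of_real)
        from tendsto_exp[OF this] show "(\<lambda>n. iexp (phase u v n y z)) \<longlonglongrightarrow> 1" by (simp add: phase)
      qed
      then show "AE z in inar_step \<alpha> pe y. (\<lambda>n. g n y z) \<longlonglongrightarrow> Complex (- (p y z ^ 2) / 2) (q y) + 1 * H z" by simp
      show "AE z in inar_step \<alpha> pe y. norm (g n y z) \<le> w y z" for n using g_bound by simp
    qed auto
    \<comment> \<open>The limit has mean \<kappa> y + (H y + k - \<kappa> y): the Poisson equation
      cancels \<kappa>, and H y + k is also the limit of n (l n - 1) + l n H y.\<close>
    moreover have "has_bochner_integral (inar_step \<alpha> pe y) (\<lambda>z. (complex_of_real (- (p y z ^ 2 / 2)) + \<i> * complex_of_real (q y)) + H z)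
        ((complex_of_real (- (- (a * real y ^ 3 + b * real y ^ 2))) + \<i> * complex_of_real (q y)) + (H y + k - \<kappa> y))"
      by (intro has_bochner_integral_add[OF hb_complex H] has_bochner_integral_minus p2 hc)
    then have "measure_pmf.expectation (inar_step \<alpha> pe y) (\<lambda>z. Complex (- (p y z ^ 2) / 2) (q y) + 1 * H z) = H y + k"
      by (simp add: has_bochner_integral_iff Complex_eq \<kappa>_def q_def)
    ultimately have "(\<lambda>n. measure_pmf.expectation (inar_step \<alpha> pe y) (g n y)) \<longlonglongrightarrow> H y + k" by simp
    then have "(\<lambda>n. measure_pmf.expectation (inar_step \<alpha> pe y) (g n y) - of_nat n * (l n - 1) - l n * H y) \<longlonglongrightarrow> (H y + k) - k - 1 * H y"
      by (intro tendsto_diff tendsto_mult l_lim l1 tendsto_const)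
    then have "(\<lambda>n. measure_pmf.expectation (inar_step \<alpha> pe y) (g n y) - of_nat n * (l n - 1) - l n * H y) \<longlonglongrightarrow> 0" by simp
    then show ?thesis
      by (rule Lim_transform_eventually) (auto intro!: eventually_sequentiallyI[of 1] simp: R_eq)
  qed
  obtain D where D: "0 \<le> D" "\<And>n y. norm (of_nat n * R n y) \<le> D * (1 + real y ^ 3)"
  proof -
    define D where "D = \<bar>- a + C * \<alpha>^3\<bar> + \<bar>- b + \<bar>v\<bar> + C * c\<^sub>3\<^sub>2\<bar> + \<bar>C * c\<^sub>3\<^sub>1\<bar> + \<bar>C * (1 + \<mu>\<^sub>3)\<bar> + \<bar>K\<bar> + C"
    have "norm (of_nat n * R n y) \<le> D * (1 + real y ^ 3)" for n y
    proof (cases "n = 0")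
      case True
      have "0 \<le> D" using C by (simp add: D_def)
      with True show ?thesis by simp
    next
      case False
      have "norm (measure_pmf.expectation (inar_step \<alpha> pe y) (g n y)) \<le> W y"
      proof -
        have "norm (measure_pmf.expectation (inar_step \<alpha> pe y) (g n y)) \<le> measure_pmf.expectation (inar_step \<alpha> pe y) (w y)"
        proof (rule order_trans[OF integral_norm_bound integral_mono])
          show "integrable (inar_step \<alpha> pe y) (w y)" using w[of y] by (simp add: has_bochner_integral_iff)
          then show "integrable (inar_step \<alpha> pe y) (\<lambda>z. norm (g n y z))"
            by (rule Bochner_Integration.integrable_bound) (auto intro!: order_trans[OF g_bound abs_ge_self])
        qed (rule g_bound)
        with w[of y] show ?thesis by (simp add: has_bochner_integral_iff)
      qed
      moreover have "W y \<le> (\<bar>- a + C * \<alpha>^3\<bar> + \<bar>- b + \<bar>v\<bar> + C * c\<^sub>3\<^sub>2\<bar> + \<bar>C * c\<^sub>3\<^sub>1\<bar> + \<bar>C * (1 + \<mu>\<^sub>3)\<bar>) * (1 + real y ^ 3)"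
      proof -
        have "W y = (- a + C * \<alpha>^3) * real y ^ 3 + (- b + \<bar>v\<bar> + C * c\<^sub>3\<^sub>2) * real y ^ 2 + (C * c\<^sub>3\<^sub>1) * real y + C * (1 + \<mu>\<^sub>3)"
          by (simp add: W_def q_def abs_mult algebra_simps)
        then show ?thesis using cubic_bound order_trans[OF abs_ge_self] by metis
      qed
      moreover have "K \<le> \<bar>K\<bar> * (1 + real y ^ 3)"
        using mult_left_mono[of 1 "1 + real y ^ 3" "\<bar>K\<bar>"] by simp
      moreover have "norm (l n * H y) \<le> C * (1 + real y ^ 3)"
        using mult_mono[OF l[of n] H_bound[of y]] by (simp add: norm_mult)
      ultimately have "norm (measure_pmf.expectation (inar_step \<alpha> pe y) (g n y)) + norm (of_nat n * (l n - 1)) + norm (l n * H y) \<le> D * (1 + real y ^ 3)"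
        unfolding D_def distrib_right[of _ _ "1 + real y ^ 3"] using K[of n] by linarith
      moreover have "norm (of_nat n * R n y) \<le> norm (measure_pmf.expectation (inar_step \<alpha> pe y) (g n y)) + norm (of_nat n * (l n - 1)) + norm (l n * H y)"
        unfolding R_eq[OF False[unfolded neq0_conv]]
        by (rule order_trans[OF norm_triangle_ineq4 add_right_mono[OF norm_triangle_ineq4]])
      ultimately show ?thesis by linarith
    qed
    moreover have "0 \<le> D" using C by (simp add: D_def)
    ultimately show thesis by (rule that[rotated])
  qed
  \<comment> \<open>An increasing majorant of n |R n|, still tending to 0 at each state and at most
    D (1 + y^3), so its mean B n over a \<open>\<pi>\<close>-distributed shift tends to 0.\<close>
  define G where "G n = running_max (\<lambda>y. norm (of_nat n * R n y))" for n
  have cube_mono: "mono (\<lambda>y::nat. c * (1 + real y ^ 3))" if "0 \<le> c" for c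
    using that by (auto simp: mono_def intro!: mult_left_mono power_mono)
  have G_bound: "G n y \<le> D * (1 + real y ^ 3)" for n y
    unfolding G_def by (rule running_max_le[OF cube_mono[OF D(1)] D(2)])
  have G_ge: "norm (of_nat n * R n y) \<le> G n y" for n y
    unfolding G_def by (rule le_running_max)
  have G_nn: "0 \<le> G n y" for n y using order_trans[OF norm_ge_zero G_ge] .
  have G_lim: "(\<lambda>n. G n y) \<longlonglongrightarrow> 0" for y
    unfolding G_def by (intro tendsto_running_max tendsto_norm_zero R_lim)
  have G_int: "integrable (measure_pmf \<pi>) (\<lambda>z. G n (y + z))" for n
    by (rule Bochner_Integration.integrable_bound[OF integrable_\<pi>_shifted_cube[of D y]])
       (auto simp: G_nn intro!: order_trans[OF G_bound] abs_ge_self)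
  define B where "B n = measure_pmf.expectation \<pi> (\<lambda>z. G n (y + z))" for n
  have B_lim: "B \<longlonglongrightarrow> 0"
  proof -
    have "B \<longlonglongrightarrow> measure_pmf.expectation \<pi> (\<lambda>z. 0)"
      unfolding B_def[abs_def]
      by (rule integral_dominated_convergence[OF _ _ integrable_\<pi>_shifted_cube[of D y]])
         (auto intro: G_lim simp: G_nn G_bound[THEN order_trans])
    then show ?thesis by simp
  qed
  define A where "A = measure_pmf.expectation \<pi> (\<lambda>z. C * (1 + real (y + z) ^ 3))"
  have B_nn: "0 \<le> B n" for n unfolding B_def by (simp add: G_nn)
  have A_nn: "0 \<le> A" unfolding A_def using C by simp
  \<comment> \<open>Each of the n - s steps contributes at most B n / n, together at most B n; A / n
    comes from replacing 1 by \<open>f n\<close> at the final state.\<close>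
  have main: "norm ((Q u v n ^^ (n - s)) (\<lambda>_. 1) y - l n ^ (n - s) * f n y) \<le> A / n + B n" if n: "0 < n" for n
  proof -
    have "(inar_op \<alpha> pe ^^ (n - s)) (\<lambda>y. ennreal (norm (1 - f n y))) y \<le>
        ennreal (measure_pmf.expectation \<pi> (\<lambda>z. C / n * (1 + real (y + z) ^ 3)))"
    proof (rule inar_op_funpow_le_expectation[where f="\<lambda>y. C / n * (1 + real y ^ 3)"])
      show "norm (1 - f n y) \<le> C / n * (1 + real y ^ 3)" for y
        using n H_bound[of y] by (simp add: f_def norm_divide field_simps)
      show "mono (\<lambda>y::nat. C / n * (1 + real y ^ 3))" using C by (intro cube_mono) simp
      show "integrable (measure_pmf \<pi>) (\<lambda>z. C / n * (1 + real (y + z) ^ 3))" by (rule integrable_\<pi>_shifted_cube)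
    qed (use C in auto)
    also have "measure_pmf.expectation \<pi> (\<lambda>z. C / n * (1 + real (y + z) ^ 3)) = A / n"
    proof -
      have "measure_pmf.expectation \<pi> (\<lambda>z. C / n * (1 + real (y + z) ^ 3)) = measure_pmf.expectation \<pi> (\<lambda>z. C * (1 + real (y + z) ^ 3) / n)"
        by simp
      then show ?thesis unfolding A_def by (simp only: integral_divide_zero)
    qed
    finally have 1: "(inar_op \<alpha> pe ^^ (n - s)) (\<lambda>y. ennreal (norm (1 - f n y))) y \<le> ennreal (A / n)" .
    have 2: "(inar_op \<alpha> pe ^^ j) (\<lambda>y. ennreal (norm (Q u v n (f n) y - l n * f n y))) y \<le> ennreal (B n / n)" for j
    proof -
      have "(inar_op \<alpha> pe ^^ j) (\<lambda>y. ennreal (norm (R n y))) y \<le> ennreal (measure_pmf.expectation \<pi> (\<lambda>z. G n (y + z) / n))"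
      proof (rule inar_op_funpow_le_expectation[where f="\<lambda>y. G n y / n"])
        show "mono (\<lambda>y. G n y / n)"
          using monoD[OF mono_running_max] by (auto simp: mono_def G_def intro!: divide_right_mono)
        show "norm (R n y) \<le> G n y / n" for y
          using n G_ge[of n y] by (simp add: norm_mult field_simps)
      qed (auto simp: G_nn G_int)
      then show ?thesis by (simp add: R_def B_def)
    qed
    have "ennreal (norm ((Q u v n ^^ (n - s)) (\<lambda>_. 1) y - l n ^ (n - s) * f n y)) \<le> ennreal (A / n) + (\<Sum>j<n-s. ennreal (B n / n))"
      by (rule order_trans[OF Q_funpow_approx[OF f_int l] add_mono[OF 1 sum_mono[OF 2]]])
    also have "\<dots> = ennreal (A / n + real (n - s) * (B n / n))"
      using A_nn B_nn by (simp add: ennreal_plus ennreal_mult ennreal_of_nat_eq_real_of_nat times_divide_eq_right[symmetric] del: times_divide_eq_right)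
    finally have "norm ((Q u v n ^^ (n - s)) (\<lambda>_. 1) y - l n ^ (n - s) * f n y) \<le> A / n + real (n - s) * (B n / n)"
      using A_nn B_nn by (subst (asm) ennreal_le_iff) auto
    also have "real (n - s) * (B n / n) \<le> real n * (B n / n)"
      using B_nn[of n] by (intro mult_right_mono) auto
    finally show ?thesis using n by simp
  qed
  have "(\<lambda>n. (Q u v n ^^ (n - s)) (\<lambda>_. 1) y - l n ^ (n - s) * f n y) \<longlonglongrightarrow> 0"
  proof (rule Lim_null_comparison)
    show "\<forall>\<^sub>F n in sequentially. norm ((Q u v n ^^ (n - s)) (\<lambda>_. 1) y - l n ^ (n - s) * f n y) \<le> A / n + B n"
      using main by (auto intro!: eventually_sequentiallyI[of 1])
    show "(\<lambda>n. A / n + B n) \<longlonglongrightarrow> 0"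
      using tendsto_add[OF lim_const_over_n[of A] B_lim] by simp
  qed
  moreover have "(\<lambda>n. l n ^ (n - s) * f n y) \<longlonglongrightarrow> exp (1 * k) * (1 + 0)"
  proof (intro tendsto_mult)
    show "(\<lambda>n. f n y) \<longlonglongrightarrow> 1 + 0"
      unfolding f_def by (intro tendsto_add tendsto_const lim_const_over_n)
    \<comment> \<open>Only n - s steps follow the outlier, whence the exponent (1 - s/n) k.\<close>
    have "(\<lambda>n. (1 - of_nat s / of_nat n) * k) \<longlonglongrightarrow> (1 - 0) * k"
      by (intro tendsto_intros lim_const_over_n)
    then have "(\<lambda>n. exp ((1 - of_nat s / of_nat n) * k)) \<longlonglongrightarrow> exp (1 * k)"
      by (intro tendsto_exp) simp
    then show "(\<lambda>n. l n ^ (n - s)) \<longlonglongrightarrow> exp (1 * k)"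
    proof (rule Lim_transform_eventually)
      show "\<forall>\<^sub>F n in sequentially. exp ((1 - of_nat s / of_nat n) * k) = l n ^ (n - s)"
      proof (rule eventually_sequentiallyI[of "Suc s"])
        fix n assume n: "Suc s \<le> n"
        have "l n ^ (n - s) = exp (of_nat (n - s) * (k / of_nat n))" unfolding l_def exp_of_nat_mult ..
        also have "of_nat (n - s) * (k / of_nat n) = (1 - of_nat s / of_nat n) * k"
          using n by (simp add: of_nat_diff field_simps)
        finally show "exp ((1 - of_nat s / of_nat n) * k) = l n ^ (n - s)" ..
      qed
    qed
  qed
  ultimately have "(\<lambda>n. ((Q u v n ^^ (n - s)) (\<lambda>_. 1) y - l n ^ (n - s) * f n y) + l n ^ (n - s) * f n y) \<longlonglongrightarrow> 0 + exp (1 * k) * (1 + 0)"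
    by (rule tendsto_add)
  then show ?thesis by (simp add: k_def)
qed

end

section \<open>The Markov property\<close>

lemma integral_bind_pmf_bounded:
  fixes f :: "'a \<Rightarrow> complex"
  assumes f: "\<And>x. norm (f x) \<le> B"
  shows "measure_pmf.expectation (bind_pmf p k) f = measure_pmf.expectation p (\<lambda>x. measure_pmf.expectation (k x) f)"
proof -
  have *: "measure_pmf.expectation (bind_pmf p k) g = measure_pmf.expectation p (\<lambda>x. measure_pmf.expectation (k x) g)"
    if "\<And>x. \<bar>g x\<bar> \<le> B" for g :: "'a \<Rightarrow> real"
    unfolding measure_pmf_bind
    using that by (intro integral_bind[where K="count_space UNIV" and B=B and B'=1] measurable_measure_pmf)
      (auto simp: measure_pmf.emeasure_space_1 intro: measure_pmf.finite_measure measure_pmf_in_subprob_algebra)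
  have i: "integrable (measure_pmf q) f" for q
    using f by (intro measure_pmf.integrable_const_bound[where B=B]) auto
  have E: "norm (measure_pmf.expectation q f) \<le> B" for q
  proof -
    have "norm (measure_pmf.expectation q f) \<le> measure_pmf.expectation q (\<lambda>x. norm (f x))"
      by (rule integral_norm_bound)
    also have "\<dots> \<le> measure_pmf.expectation q (\<lambda>_. B)"
      by (intro integral_mono integrable_norm i f) auto
    finally show ?thesis by simp
  qed
  have i2: "integrable (measure_pmf p) (\<lambda>x. measure_pmf.expectation (k x) f)"
    using E by (intro measure_pmf.integrable_const_bound[where B=B]) auto
  have ReIm: "\<bar>Re (f x)\<bar> \<le> B" "\<bar>Im (f x)\<bar> \<le> B" for x
    using order_trans[OF abs_Re_le_cmod f] order_trans[OF abs_Im_le_cmod f] by auto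
  show ?thesis
    by (rule complex_eqI)
      (simp_all only: integral_Re[OF i, symmetric] integral_Re[OF i2, symmetric] *[OF ReIm(1)]
        integral_Im[OF i, symmetric] integral_Im[OF i2, symmetric] *[OF ReIm(2)])
qed

lemma measurable_add_nat:
  fixes f g :: "'a \<Rightarrow> nat"
  assumes [measurable]: "f \<in> measurable M (count_space UNIV)" "g \<in> measurable M (count_space UNIV)"
  shows "(\<lambda>x. f x + g x) \<in> measurable M (count_space UNIV)"
  by measurable

lemma measurable_sum_nat:
  fixes f :: "'i \<Rightarrow> 'a \<Rightarrow> nat"
  assumes "\<And>i. i \<in> I \<Longrightarrow> f i \<in> measurable M (count_space UNIV)"
  shows "(\<lambda>x. \<Sum>i\<in>I. f i x) \<in> measurable M (count_space UNIV)"
  using assms by (induction I rule: infinite_finite_induct) (auto intro: measurable_add_nat)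

text \<open>On a countable type the points of mass 0 form a countable union of null sets, so the law
  sits on its atoms. Applied to histories, whose law is not given explicitly.\<close>

lemma (in prob_space) ex_law_pmf:
  fixes X :: "'a \<Rightarrow> 'b::countable"
  assumes X: "X \<in> measurable M (count_space UNIV)"
  obtains p where "distr M (count_space UNIV) X = measure_pmf p"
proof -
  let ?D = "distr M (count_space UNIV) X"
  interpret D: prob_space ?D by (rule prob_space_distr[OF X])
  have "AE x in ?D. measure ?D {x} \<noteq> 0"
  proof (rule AE_I)
    show "{x \<in> space ?D. \<not> measure ?D {x} \<noteq> 0} \<subseteq> (\<Union>x\<in>{x. measure ?D {x} = 0}. {x})" by auto
    have "(\<Union>x\<in>{x. measure ?D {x} = 0}. {x}) \<in> null_sets ?D"
      by (intro null_sets_UN') (auto simp: null_sets_def D.emeasure_eq_measure)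
    then show "emeasure ?D (\<Union>x\<in>{x. measure ?D {x} = 0}. {x}) = 0" by auto
  qed auto
  then have "measure_pmf (Abs_pmf ?D) = ?D"
    using D.prob_space_axioms by (intro Abs_pmf_inverse) auto
  then show thesis using that by metis
qed

lemma (in prob_space) prob_eq_pmf:
  assumes "X \<in> measurable M (count_space UNIV)" "distr M (count_space UNIV) X = measure_pmf p"
  shows "prob {x \<in> space M. X x = a} = pmf p a"
proof -
  have "pmf p a = measure (distr M (count_space UNIV) X) {a}"
    by (simp add: assms(2) pmf.rep_eq)
  also have "\<dots> = prob (X -` {a} \<inter> space M)" using assms(1) by (subst measure_distr) auto
  also have "X -` {a} \<inter> space M = {x \<in> space M. X x = a}" by auto
  finally show ?thesis ..
qed

lemma (in prob_space) distr_eq_measure_pmfI: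
  fixes X :: "'a \<Rightarrow> 'b::countable"
  assumes X: "X \<in> measurable M (count_space UNIV)"
    and eq: "\<And>a. prob {x \<in> space M. X x = a} = pmf p a"
  shows "distr M (count_space UNIV) X = measure_pmf p"
proof (rule measure_eqI_countable[of _ UNIV])
  fix a
  have "emeasure (distr M (count_space UNIV) X) {a} = emeasure M (X -` {a} \<inter> space M)"
    using X by (subst emeasure_distr) auto
  also have "X -` {a} \<inter> space M = {x \<in> space M. X x = a}" by auto
  finally show "emeasure (distr M (count_space UNIV) X) {a} = emeasure (measure_pmf p) {a}"
    by (simp add: emeasure_eq_measure eq emeasure_pmf_single)
qed auto

lemma (in prob_space) indep_var_prob_eq:
  assumes "indep_var (count_space UNIV) A (count_space UNIV) B"
  shows "prob {x \<in> space M. A x = a \<and> B x = b} = prob {x \<in> space M. A x = a} * prob {x \<in> space M. B x = b}"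
  using indep_varD[OF assms, of "{a}" "{b}"]
  by (simp add: vimage_def Int_def conj_commute cong: conj_cong)

lemma (in prob_space) indep_var_distr_add:
  fixes A B :: "'a \<Rightarrow> nat"
  assumes indep: "indep_var (count_space UNIV) A (count_space UNIV) B"
    and A: "distr M (count_space UNIV) A = measure_pmf p" and B: "distr M (count_space UNIV) B = measure_pmf q"
  shows "distr M (count_space UNIV) (\<lambda>x. A x + B x) = measure_pmf (bind_pmf p (\<lambda>a. map_pmf (\<lambda>b. a + b) q))"
proof -
  have rv: "A \<in> measurable M (count_space UNIV)" "B \<in> measurable M (count_space UNIV)"
    using indep_var_rv1[OF indep] indep_var_rv2[OF indep] by auto
  have rv2: "(\<lambda>x. (A x, B x)) \<in> measurable M (count_space UNIV)"
    using rv by measurable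
  have "distr M (count_space UNIV) (\<lambda>x. (A x, B x)) = measure_pmf (pair_pmf p q)"
  proof (rule distr_eq_measure_pmfI[OF rv2])
    fix ab :: "nat \<times> nat"
    show "prob {x \<in> space M. (A x, B x) = ab} = pmf (pair_pmf p q) ab"
      using indep_var_prob_eq[OF indep, of "fst ab" "snd ab"] prob_eq_pmf[OF rv(1) A] prob_eq_pmf[OF rv(2) B]
      by (cases ab) (simp add: pmf_pair)
  qed
  then have "distr (distr M (count_space UNIV) (\<lambda>x. (A x, B x))) (count_space UNIV) (\<lambda>(a, b). a + b)
     = measure_pmf (map_pmf (\<lambda>(a, b). a + b) (pair_pmf p q))"
    by (simp add: map_pmf_rep_eq)
  also have "distr (distr M (count_space UNIV) (\<lambda>x. (A x, B x))) (count_space UNIV) (\<lambda>(a, b). a + b) =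
     distr M (count_space UNIV) (\<lambda>x. A x + B x)"
    using rv2 by (subst distr_distr) (auto simp: o_def)
  also have "map_pmf (\<lambda>(a, b). a + b) (pair_pmf p q) = bind_pmf p (\<lambda>a. map_pmf (\<lambda>b. a + b) q)"
    by (simp add: pair_pmf_def map_bind_pmf map_pmf_def bind_assoc_pmf bind_return_pmf)
  finally show ?thesis .
qed

section \<open>Histories and the noise that determines them\<close>

definition idx_upto :: "nat \<Rightarrow> inar_idx set" where
  "idx_upto n = {Eps k | k. 1 \<le> k \<and> k \<le> n} \<union> {Xi k j | k j. 1 \<le> k \<and> k \<le> n \<and> 1 \<le> j} \<union> {Init}"

text \<open>Lists of naturals form a countable type, so the entire past is one discrete variable and
  conditioning on it concerns atoms only.\<close>

definition hist :: "(nat \<Rightarrow> 'a \<Rightarrow> nat) \<Rightarrow> nat \<Rightarrow> 'a \<Rightarrow> nat list" where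
  "hist Y k x = map (\<lambda>i. Y i x) [0..<Suc k]"

lemma hist_Suc: "hist Y (Suc k) x = hist Y k x @ [Y (Suc k) x]"
  by (simp add: hist_def)

lemma last_hist: "last (hist Y k x) = Y k x"
  by (simp add: hist_def)

lemma nth_hist: "i \<le> k \<Longrightarrow> hist Y k x ! i = Y i x"
  by (simp add: hist_def del: upt_Suc)

lemma take_hist: "i \<le> k \<Longrightarrow> take (Suc i) (hist Y k x) = hist Y i x"
  by (simp add: hist_def take_map del: upt_Suc)

text \<open>Stated for an arbitrary space N, to serve both the given probability space and the
  product space of noise coordinates.\<close>

lemma measurable_inar_Y:
  assumes "\<And>i. i \<in> idx_upto n \<Longrightarrow> inar_rv xi eps Y0 i \<in> measurable N (count_space UNIV)" "k \<le> n"
  shows "inar_Y s \<theta> xi eps Y0 k \<in> measurable N (count_space UNIV)"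
  using assms(2)
proof (induction k)
  case 0
  have "inar_Y s \<theta> xi eps Y0 0 = inar_rv xi eps Y0 Init" by (auto simp: inar_rv_def)
  then show ?case using assms(1)[of Init] by (simp add: idx_upto_def)
next
  case (Suc k)
  have e: "eps (Suc k) \<in> measurable N (count_space UNIV)"
    using assms(1)[of "Eps (Suc k)"] Suc.prems by (simp add: idx_upto_def inar_rv_def)
  have x: "xi (Suc k) j \<in> measurable N (count_space UNIV)" if "1 \<le> j" for j
    using assms(1)[of "Xi (Suc k) j"] Suc.prems that by (simp add: idx_upto_def inar_rv_def)
  have "(\<lambda>w. \<Sum>j = 1..inar_Y s \<theta> xi eps Y0 k w. xi (Suc k) j w) \<in> measurable N (count_space UNIV)"
  \<comment> \<open>The random upper limit takes countably many values, and for each fixed value the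
    sum is measurable.\<close>
  proof (rule measurable_compose_countable[where g="inar_Y s \<theta> xi eps Y0 k" and f="\<lambda>m w. \<Sum>j = 1..m. xi (Suc k) j w"])
    show "(\<lambda>w. \<Sum>j = 1..m. xi (Suc k) j w) \<in> measurable N (count_space UNIV)" for m
      by (intro measurable_sum_nat x) auto
  qed (use Suc in auto)
  then have "(\<lambda>w. (\<Sum>j = 1..inar_Y s \<theta> xi eps Y0 k w. xi (Suc k) j w) + eps (Suc k) w + (if Suc k = s then \<theta> else 0))
     \<in> measurable N (count_space UNIV)"
    by (intro measurable_add_nat e) auto
  moreover have "inar_Y s \<theta> xi eps Y0 (Suc k) =
     (\<lambda>w. (\<Sum>j = 1..inar_Y s \<theta> xi eps Y0 k w. xi (Suc k) j w) + eps (Suc k) w + (if Suc k = s then \<theta> else 0))"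
    by auto
  ultimately show ?case by simp
qed

lemma measurable_hist:
  assumes "\<And>i. i \<le> k \<Longrightarrow> Y i \<in> measurable N (count_space UNIV)"
  shows "hist Y k \<in> measurable N (count_space UNIV)"
  using assms
proof (induction k)
  case 0
  have "hist Y 0 = (\<lambda>x. [Y 0 x])" by (auto simp: hist_def)
  with 0[of 0] show ?case by (auto intro: measurable_compose)
next
  case (Suc k)
  have "(\<lambda>x. hist Y k x @ [Y (Suc k) x]) \<in> measurable N (count_space UNIV)"
    using Suc by (intro measurable_compose_countable[where g="hist Y k" and f="\<lambda>l x. l @ [Y (Suc k) x]"])
      (auto intro: measurable_compose)
  then show ?case by (simp add: hist_Suc[abs_def])
qed

text \<open>The same recursion on the coordinate space. It exhibits the path as a function of the
  noise restricted to \<open>idx_upto n\<close>, the form in which independence of disjoint index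
  blocks can be used.\<close>

abbreviation coord_Y :: "nat \<Rightarrow> nat \<Rightarrow> nat \<Rightarrow> (inar_idx \<Rightarrow> nat) \<Rightarrow> nat" where
  "coord_Y s \<theta> \<equiv> inar_Y s \<theta> (\<lambda>k j w. w (Xi k j)) (\<lambda>k w. w (Eps k)) (\<lambda>w. w Init)"

lemma inar_Y_eq_coord_Y:
  assumes "k \<le> n"
  shows "inar_Y s \<theta> xi eps Y0 k x = coord_Y s \<theta> k (restrict (\<lambda>i. inar_rv xi eps Y0 i x) (idx_upto n))"
  using assms
proof (induction k)
  case (Suc k)
  then show ?case by (auto simp: idx_upto_def inar_rv_def intro!: sum.cong)
qed (simp add: idx_upto_def inar_rv_def)

locale inar_path = inar_chain \<alpha> pe + prob_space M
  for \<alpha> :: real and pe :: "nat pmf" and M :: "'a measure" +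
  fixes xi :: "nat \<Rightarrow> nat \<Rightarrow> 'a \<Rightarrow> nat" and eps :: "nat \<Rightarrow> 'a \<Rightarrow> nat" and Y0 :: "'a \<Rightarrow> nat"
    and s \<theta> :: nat
  assumes s_ge_1: "1 \<le> s"
    and indep: "indep_vars (\<lambda>_. count_space UNIV) (inar_rv xi eps Y0) inar_indices"
    and eps_law: "\<And>k. 1 \<le> k \<Longrightarrow> distr M (count_space UNIV) (eps k) = measure_pmf pe"
    and xi_law: "\<And>k j. 1 \<le> k \<Longrightarrow> 1 \<le> j \<Longrightarrow>
                   distr M (count_space UNIV) (xi k j) = measure_pmf (map_pmf of_bool (bernoulli_pmf \<alpha>))"
begin

abbreviation Y :: "nat \<Rightarrow> 'a \<Rightarrow> nat" where "Y \<equiv> inar_Y s \<theta> xi eps Y0"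

lemma idx_upto_subset: "idx_upto n \<subseteq> inar_indices"
  by (auto simp: idx_upto_def inar_indices_def)

lemma measurable_inar_rv: "i \<in> inar_indices \<Longrightarrow> inar_rv xi eps Y0 i \<in> measurable M (count_space UNIV)"
  using indep by (auto simp: indep_vars_def)

lemma measurable_Y [measurable]: "Y k \<in> measurable M (count_space UNIV)"
  by (rule measurable_inar_Y[of k]) (use idx_upto_subset in \<open>auto intro: measurable_inar_rv\<close>)

lemma measurable_hist_Y [measurable]: "hist Y k \<in> measurable M (count_space UNIV)"
  by (rule measurable_hist) (rule measurable_Y)

text \<open>The state at time k without outlier, with the preceding population frozen at the number
  y; freezing makes it a function of the time-k noise alone.\<close>

definition offspring :: "nat \<Rightarrow> nat \<Rightarrow> 'a \<Rightarrow> nat" where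
  "offspring k y x = (\<Sum>j = 1..y. xi k j x) + eps k x"

lemma prob_hist_offspring:
  "prob {x \<in> space M. hist Y k x = l \<and> offspring (Suc k) y x = z} =
    prob {x \<in> space M. hist Y k x = l} * prob {x \<in> space M. offspring (Suc k) y x = z}"
proof -
  let ?A = "idx_upto k" and ?B = "{Eps (Suc k)} \<union> {Xi (Suc k) j | j. 1 \<le> j}"
  let ?X = "inar_rv xi eps Y0"
  let ?C = "\<lambda>S. PiM S (\<lambda>_. count_space UNIV :: nat measure)"
  let ?f = "hist (coord_Y s \<theta>) k"
  \<comment> \<open>\<open>indep_var\<close> takes two variables of one type, hence a singleton list
    to match the history.\<close>
  let ?g = "\<lambda>w. [(\<Sum>j = 1..y. w (Xi (Suc k) j)) + w (Eps (Suc k))]"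
  have i: "indep_var (?C ?A) (\<lambda>x. restrict (\<lambda>i. ?X i x) ?A) (?C ?B) (\<lambda>x. restrict (\<lambda>i. ?X i x) ?B)"
    by (rule indep_var_restrict[OF indep]) (auto simp: idx_upto_def inar_indices_def)
  have f: "?f \<in> measurable (?C ?A) (count_space UNIV)"
  proof (rule measurable_hist, rule measurable_inar_Y[of k])
    fix i assume "i \<in> idx_upto k"
    moreover have "inar_rv (\<lambda>k j w. w (Xi k j)) (\<lambda>k w. w (Eps k)) (\<lambda>w. w Init) i = (\<lambda>w. w i)"
      by (cases i) (auto simp: inar_rv_def)
    ultimately show "inar_rv (\<lambda>k j w. w (Xi k j)) (\<lambda>k w. w (Eps k)) (\<lambda>w. w Init) i \<in> measurable (?C ?A) (count_space UNIV)"
      by (simp add: measurable_component_singleton)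
  qed
  have g: "?g \<in> measurable (?C ?B) (count_space UNIV)"
    by (rule measurable_compose[where g="\<lambda>a. [a]" and N="count_space UNIV"])
      (auto intro!: measurable_add_nat measurable_sum_nat measurable_component_singleton)
  have "?f \<circ> (\<lambda>x. restrict (\<lambda>i. ?X i x) ?A) = hist Y k"
    using inar_Y_eq_coord_Y[of _ k s \<theta> xi eps Y0] by (auto simp: hist_def)
  moreover have "?g \<circ> (\<lambda>x. restrict (\<lambda>i. ?X i x) ?B) = (\<lambda>x. [offspring (Suc k) y x])"
    by (auto simp: offspring_def inar_rv_def fun_eq_iff intro!: sum.cong)
  ultimately show ?thesis
    using indep_var_prob_eq[OF indep_var_compose[OF i f g], of l "[z]"] by simp
qed

lemma measurable_offspring: "offspring (Suc k) y \<in> measurable M (count_space UNIV)"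
  unfolding offspring_def
proof (intro measurable_add_nat measurable_sum_nat)
  show "xi (Suc k) j \<in> measurable M (count_space UNIV)" if "j \<in> {1..y}" for j
    using measurable_inar_rv[of "Xi (Suc k) j"] that by (simp add: inar_rv_def inar_indices_def)
  show "eps (Suc k) \<in> measurable M (count_space UNIV)"
    using measurable_inar_rv[of "Eps (Suc k)"] by (simp add: inar_rv_def inar_indices_def)
qed

lemma indep_xi_offspring:
  assumes "1 \<le> k"
  shows "indep_var (count_space UNIV) (xi k (Suc y)) (count_space UNIV) (offspring k y)"
proof -
  let ?A = "{Xi k (Suc y)}" and ?B = "{Eps k} \<union> {Xi k j | j. 1 \<le> j \<and> j \<le> y}"
  let ?X = "inar_rv xi eps Y0"
  let ?C = "\<lambda>S. PiM S (\<lambda>_. count_space UNIV :: nat measure)"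
  let ?f = "\<lambda>w :: inar_idx \<Rightarrow> nat. w (Xi k (Suc y))"
  let ?g = "\<lambda>w. (\<Sum>j = 1..y. w (Xi k j)) + w (Eps k)"
  have i: "indep_var (?C ?A) (\<lambda>x. restrict (\<lambda>i. ?X i x) ?A) (?C ?B) (\<lambda>x. restrict (\<lambda>i. ?X i x) ?B)"
    by (rule indep_var_restrict[OF indep]) (use assms in \<open>auto simp: inar_indices_def\<close>)
  have f: "?f \<in> measurable (?C ?A) (count_space UNIV)"
    by (intro measurable_component_singleton) auto
  have g: "?g \<in> measurable (?C ?B) (count_space UNIV)"
    by (intro measurable_add_nat measurable_sum_nat measurable_component_singleton) auto
  have "?f \<circ> (\<lambda>x. restrict (\<lambda>i. ?X i x) ?A) = xi k (Suc y)"
    by (auto simp: inar_rv_def)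
  moreover have "?g \<circ> (\<lambda>x. restrict (\<lambda>i. ?X i x) ?B) = offspring k y"
    by (auto simp: offspring_def inar_rv_def fun_eq_iff intro!: sum.cong)
  ultimately show ?thesis
    using indep_var_compose[OF i f g] by simp
qed

text \<open>Adding one independent thinning variable reproduces the recursion
  \<open>inar_step_Suc\<close>.\<close>

lemma distr_offspring:
  assumes "1 \<le> k"
  shows "distr M (count_space UNIV) (offspring k y) = measure_pmf (inar_step \<alpha> pe y)"
proof (induction y)
  case 0
  then show ?case using eps_law[OF assms] by (simp add: offspring_def[abs_def] inar_step_0[OF \<alpha>])
next
  case (Suc y)
  have "offspring k (Suc y) = (\<lambda>x. xi k (Suc y) x + offspring k y x)"
    by (auto simp: offspring_def)
  then show ?case
    using indep_var_distr_add[OF indep_xi_offspring[OF assms] xi_law[OF assms] Suc.IH]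
    by (simp add: inar_step_Suc[OF \<alpha>] bind_map_pmf)
qed

lemma Y_Suc_eq_offspring: "Suc k \<noteq> s \<Longrightarrow> Y (Suc k) x = offspring (Suc k) (Y k x) x"
  by (simp add: offspring_def)

lemma markov:
  fixes h :: "nat list \<Rightarrow> nat \<Rightarrow> complex"
  assumes k: "Suc k \<noteq> s" and h: "\<And>l z. norm (h l z) \<le> B"
  shows "expectation (\<lambda>x. h (hist Y k x) (Y (Suc k) x)) =
    expectation (\<lambda>x. measure_pmf.expectation (inar_step \<alpha> pe (Y k x)) (h (hist Y k x)))"
proof -
  obtain p where p: "distr M (count_space UNIV) (hist Y k) = measure_pmf p"
    using ex_law_pmf[OF measurable_hist_Y] by blast
  have rv2: "(\<lambda>x. (hist Y k x, Y (Suc k) x)) \<in> measurable M (count_space UNIV)"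
    by measurable
  have j: "distr M (count_space UNIV) (\<lambda>x. (hist Y k x, Y (Suc k) x)) =
     measure_pmf (bind_pmf p (\<lambda>l. map_pmf (Pair l) (inar_step \<alpha> pe (last l))))"
  proof (rule distr_eq_measure_pmfI[OF rv2])
    fix lz :: "nat list \<times> nat"
    obtain l z where lz: "lz = (l, z)" by (cases lz)
    have "{x \<in> space M. (hist Y k x, Y (Suc k) x) = lz} = {x \<in> space M. hist Y k x = l \<and> offspring (Suc k) (last l) x = z}"
      unfolding lz by (auto simp: Y_Suc_eq_offspring[OF k] last_hist simp del: inar_Y.simps)
    then have "prob {x \<in> space M. (hist Y k x, Y (Suc k) x) = lz} = pmf p l * pmf (inar_step \<alpha> pe (last l)) z"
      using prob_hist_offspring prob_eq_pmf[OF measurable_hist_Y p]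
        prob_eq_pmf[OF measurable_offspring distr_offspring] by simp
    also have "\<dots> = pmf (bind_pmf p (\<lambda>l. map_pmf (Pair l) (inar_step \<alpha> pe (last l)))) (l, z)"
    proof -
      have "pmf (map_pmf (Pair l') (inar_step \<alpha> pe (last l'))) (l, z) = indicator {l} l' * pmf (inar_step \<alpha> pe (last l)) z" for l'
      proof (cases "l' = l")
        case True
        then show ?thesis by (simp add: pmf_map_inj' inj_on_def)
      next
        case False
        then have "(l, z) \<notin> Pair l' ` set_pmf (inar_step \<alpha> pe (last l'))" by auto
        then show ?thesis using False by (simp add: pmf_map_outside)
      qed
      then show ?thesis by (simp add: pmf_bind measure_pmf_single)
    qed
    finally show "prob {x \<in> space M. (hist Y k x, Y (Suc k) x) = lz} =
      pmf (bind_pmf p (\<lambda>l. map_pmf (Pair l) (inar_step \<alpha> pe (last l)))) lz" by (simp add: lz)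
  qed
  have "expectation (\<lambda>x. h (hist Y k x) (Y (Suc k) x)) =
    integral\<^sup>L (distr M (count_space UNIV) (\<lambda>x. (hist Y k x, Y (Suc k) x))) (case_prod h)"
    using rv2 by (subst integral_distr) auto
  also have "\<dots> = measure_pmf.expectation p (\<lambda>l. measure_pmf.expectation (map_pmf (Pair l) (inar_step \<alpha> pe (last l))) (case_prod h))"
    unfolding j using h by (intro integral_bind_pmf_bounded[where B=B]) auto
  also have "\<dots> = measure_pmf.expectation p (\<lambda>l. measure_pmf.expectation (inar_step \<alpha> pe (last l)) (h l))"
    by simp
  also have "\<dots> = expectation (\<lambda>x. measure_pmf.expectation (inar_step \<alpha> pe (last (hist Y k x))) (h (hist Y k x)))"
    unfolding p[symmetric] by (subst integral_distr) auto
  finally show ?thesis by (simp add: last_hist)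
qed

text \<open>Integrating out the last transition replaces f by Q f. The factor F leaves room for the
  conditioning event and the phases before the outlier.\<close>

lemma markov_iterated:
  fixes F :: "nat list \<Rightarrow> complex" and f :: "nat \<Rightarrow> complex"
  assumes F: "\<And>l. norm (F l) \<le> 1" and f: "\<And>y. norm (f y) \<le> 1"
  shows "expectation (\<lambda>x. F (hist Y s x) * (\<Prod>k<N. iexp (phase u v n (Y (s + k) x) (Y (Suc (s + k)) x))) * f (Y (s + N) x)) =
    expectation (\<lambda>x. F (hist Y s x) * (Q u v n ^^ N) f (Y s x))"
  using f
proof (induction N arbitrary: f)
  case (Suc N)
  \<comment> \<open>All factors known at time s + N as a function of the history, so that only the
    last transition remains random in \<open>markov\<close>.\<close>
  define G where "G l = F (take (Suc s) l) * (\<Prod>k<N. iexp (phase u v n (l ! (s + k)) (l ! (Suc (s + k)))))" for l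
  have G: "norm (G l) \<le> 1" for l
    using F by (simp add: G_def norm_mult prod_norm[symmetric])
  have G_hist: "G (hist Y (s + N) x) = F (hist Y s x) * (\<Prod>k<N. iexp (phase u v n (Y (s + k) x) (Y (Suc (s + k)) x)))" for x
    by (simp add: G_def take_hist nth_hist del: inar_Y.simps)
  have "expectation (\<lambda>x. F (hist Y s x) * (\<Prod>k<Suc N. iexp (phase u v n (Y (s + k) x) (Y (Suc (s + k)) x))) * f (Y (s + Suc N) x))
    = expectation (\<lambda>x. (\<lambda>l z. G l * (iexp (phase u v n (last l) z) * f z)) (hist Y (s + N) x) (Y (Suc (s + N)) x))"
    by (simp add: G_hist last_hist mult_ac del: inar_Y.simps)
  also have "\<dots> = expectation (\<lambda>x. measure_pmf.expectation (inar_step \<alpha> pe (Y (s + N) x))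
     ((\<lambda>l z. G l * (iexp (phase u v n (last l) z) * f z)) (hist Y (s + N) x)))"
    using G Suc.prems by (intro markov[where B=1]) (auto simp: norm_mult mult_le_one)
  also have "\<dots> = expectation (\<lambda>x. F (hist Y s x) * (\<Prod>k<N. iexp (phase u v n (Y (s + k) x) (Y (Suc (s + k)) x))) * Q u v n f (Y (s + N) x))"
    by (simp add: G_hist last_hist Q_def del: inar_Y.simps)
  also have "\<dots> = expectation (\<lambda>x. F (hist Y s x) * (Q u v n ^^ N) (Q u v n f) (Y s x))"
    by (rule Suc.IH) (rule norm_Q_le, rule Suc.prems)
  finally show ?case by (simp only: funpow_Suc_right o_apply)
qed simp

end

section \<open>Limit theorems for the estimators\<close>

text \<open>Scaling a standard normal variable covers the density and the point mass at v = 0 by one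
  formula.\<close>

lemma normal_law_eq_distr:
  assumes "0 \<le> v"
  shows "normal_law v = distr std_normal_distribution borel (\<lambda>z. sqrt v * z)"
proof (cases "v = 0")
  case True
  interpret real_distribution std_normal_distribution by (rule real_dist_normal_dist)
  have "distr std_normal_distribution borel (\<lambda>z. 0 :: real) = return borel 0"
    by (rule distr_const) simp
  with True show ?thesis by (simp add: normal_law_def)
next
  case False
  interpret real_distribution std_normal_distribution by (rule real_dist_normal_dist)
  have v: "0 < sqrt v" using False assms by simp
  have "distributed std_normal_distribution lborel (\<lambda>z. (sqrt v * z - 0) / sqrt v) std_normal_density"
    using v by (simp add: distributed_def distr_id2)
  then have "distributed std_normal_distribution lborel (\<lambda>z. sqrt v * z) (normal_density 0 (sqrt v))"
    using normal_standard_normal_convert[of "sqrt v" "\<lambda>z. sqrt v * z" 0] v by simp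
  then have "distr std_normal_distribution lborel (\<lambda>z. sqrt v * z) = density lborel (normal_density 0 (sqrt v))"
    by (simp add: distributed_def)
  moreover have "distr std_normal_distribution lborel (\<lambda>z. sqrt v * z) = distr std_normal_distribution borel (\<lambda>z. sqrt v * z)"
    by (rule distr_cong) auto
  ultimately show ?thesis using False by (simp add: normal_law_def)
qed

lemma real_distribution_affine_normal:
  "real_distribution (distr std_normal_distribution borel (\<lambda>z. a * z + c))"
proof -
  interpret real_distribution std_normal_distribution by (rule real_dist_normal_dist)
  show ?thesis by (rule real_distribution_distr) simp
qed

lemma char_affine_normal:
  "char (distr std_normal_distribution borel (\<lambda>z. a * z + c)) t = exp (Complex (- (t^2 * a^2 / 2)) (t * c))"
proof -
  interpret real_distribution std_normal_distribution by (rule real_dist_normal_dist)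
  have "char (distr std_normal_distribution borel (\<lambda>z. a * z + c)) t
      = (CLINT z|std_normal_distribution. iexp (t * c) * iexp ((t * a) * z))"
    unfolding char_def by (subst integral_distr) (auto simp: exp_add[symmetric] algebra_simps)
  also have "\<dots> = iexp (t * c) * char std_normal_distribution (t * a)"
    unfolding char_def by simp
  also have "\<dots> = exp (Complex (- (t^2 * a^2 / 2)) (t * c))"
    unfolding char_std_normal_distribution exp_of_real[symmetric] mult_exp_exp
    by (simp add: Complex_eq power_mult_distrib algebra_simps)
  finally show ?thesis .
qed

lemma std_normal_singleton: "measure std_normal_distribution {a} = 0"
proof -
  have "{a} \<in> null_sets lborel" by (auto simp: null_sets_def)
  moreover have "absolutely_continuous lborel std_normal_distribution"
    by (rule absolutely_continuousI_density) simp
  ultimately have "{a} \<in> null_sets std_normal_distribution"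
    by (auto simp: absolutely_continuous_def)
  then show ?thesis by (auto simp: null_sets_def measure_def)
qed

lemma cdf_distr:
  assumes "X \<in> borel_measurable N"
  shows "cdf (distr N borel X) a = measure N {x \<in> space N. X x \<le> a}"
  unfolding cdf_def using assms by (subst measure_distr) (auto intro!: arg_cong[where f="measure N"])

lemma integral_uniform_measure:
  fixes f :: "'a \<Rightarrow> complex"
  assumes "prob_space M" and A: "A \<in> sets M" "0 < measure M A" and f: "f \<in> borel_measurable M"
  shows "integral\<^sup>L (uniform_measure M A) f = integral\<^sup>L M (\<lambda>x. indicator A x * f x) / measure M A"
proof -
  interpret prob_space M by fact
  have "uniform_measure M A = density M (\<lambda>x. ennreal (indicator A x / measure M A))"
    unfolding uniform_measure_def
    using A by (intro density_cong) (auto simp: emeasure_eq_measure ennreal_indicator[symmetric] divide_ennreal)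
  then have "integral\<^sup>L (uniform_measure M A) f = integral\<^sup>L M (\<lambda>x. (indicator A x / measure M A) *\<^sub>R f x)"
    using A f by (simp add: integral_density)
  also have "(\<lambda>x. (indicator A x / measure M A) *\<^sub>R f x) = (\<lambda>x. (indicator A x * f x) / measure M A)"
    by (auto simp: fun_eq_iff indicator_def scaleR_conv_of_real)
  finally show ?thesis by simp
qed

lemma sum_skip_split:
  fixes g :: "nat \<Rightarrow> 'b::comm_monoid_add"
  assumes "1 \<le> s"
  shows "(\<Sum>k\<in>{1..s + N} - {s}. g k) = (\<Sum>k\<in>{1..<s}. g k) + (\<Sum>k<N. g (Suc (s + k)))"
proof (induction N)
  case 0
  have "{1..s + 0} - {s} = {1..<s}" by auto
  then show ?case by simp
next
  case (Suc N)
  have "{1..s + Suc N} - {s} = insert (Suc (s + N)) ({1..s + N} - {s})" using assms by auto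
  then have "(\<Sum>k\<in>{1..s + Suc N} - {s}. g k) = g (Suc (s + N)) + (\<Sum>k\<in>{1..s + N} - {s}. g k)"
    by simp
  then show ?case using Suc by (simp add: ac_simps)
qed

context inar_path
begin

section \<open>Score, information and their joint limit\<close>

definition score :: "nat \<Rightarrow> 'a \<Rightarrow> real" where
  "score n x = (\<Sum>k\<in>{1..n} - {s}. (real (Y k x) - \<alpha> * Y (k - 1) x - \<mu>) * Y (k - 1) x)"

definition info :: "nat \<Rightarrow> 'a \<Rightarrow> real" where
  "info n x = (\<Sum>k\<in>{1..n} - {s}. real (Y (k - 1) x) ^ 2)"

lemma measurable_real_Y [measurable]: "(\<lambda>x. real (Y k x)) \<in> borel_measurable M"
  by (rule measurable_compose[OF measurable_Y]) simp

lemma measurable_score [measurable]: "score n \<in> borel_measurable M"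
  unfolding score_def[abs_def] by measurable

lemma measurable_info [measurable]: "info n \<in> borel_measurable M"
  unfolding info_def[abs_def] by measurable

lemma info_nonneg: "0 \<le> info n x"
  unfolding info_def by (intro sum_nonneg) simp

lemma info_eq_0: "info n x = 0 \<Longrightarrow> score n x = 0"
  unfolding info_def score_def by (subst (asm) sum_nonneg_eq_0_iff) (auto intro!: sum.neutral)

lemma cls_alpha_eq: "cls_alpha s \<mu> Y n x = (if 0 < info n x then score n x / info n x + \<alpha> else 0)"
proof -
  have *: "(\<Sum>k\<in>{1..n} - {s}. (real (Y k x) - \<mu>) * real (Y (k - 1) x)) = score n x + \<alpha> * info n x"
    unfolding score_def info_def sum_distrib_left sum.distrib[symmetric]
    by (intro sum.cong) (auto simp: algebra_simps power2_eq_square)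
  show ?thesis unfolding cls_alpha_def Let_def * info_def[symmetric] by (simp add: add_divide_distrib)
qed

lemma measurable_cls_alpha [measurable]: "cls_alpha s \<mu> Y n \<in> borel_measurable M"
  unfolding cls_alpha_eq[abs_def] by measurable

lemma phase_tendsto_0: "(\<lambda>n. phase u v n y z) \<longlonglongrightarrow> 0"
proof -
  have "(\<lambda>n. u * ((real z - \<alpha> * y - \<mu>) * y) / sqrt (real n) + v * real y ^ 2 / real n) \<longlonglongrightarrow> 0 + 0"
    by (intro tendsto_add lim_const_over_n tendsto_divide_0[OF tendsto_const]
       filterlim_at_top_imp_at_infinity filterlim_compose[OF sqrt_at_top filterlim_real_sequentially])
  then show ?thesis by (simp add: phase_def)
qed

lemma iexp_score_info:
  assumes "s \<le> n"
  shows "iexp (u / sqrt n * score n x + v / n * info n x) =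
    iexp (\<Sum>k\<in>{1..<s}. phase u v n (Y (k - 1) x) (Y k x)) *
    (\<Prod>k<n - s. iexp (phase u v n (Y (s + k) x) (Y (Suc (s + k)) x)))"
proof -
  have "u / sqrt n * score n x + v / n * info n x = (\<Sum>k\<in>{1..n} - {s}. phase u v n (Y (k - 1) x) (Y k x))"
    unfolding score_def info_def sum_distrib_left sum.distrib[symmetric] phase_def ..
  also have "{1..n} - {s} = {1..s + (n - s)} - {s}" using assms by simp
  also have "(\<Sum>k\<in>{1..s + (n - s)} - {s}. phase u v n (Y (k - 1) x) (Y k x)) =
     (\<Sum>k\<in>{1..<s}. phase u v n (Y (k - 1) x) (Y k x)) + (\<Sum>k<n - s. phase u v n (Y (s + k) x) (Y (Suc (s + k)) x))"
    unfolding sum_skip_split[OF s_ge_1] by (simp del: inar_Y.simps)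
  finally show ?thesis
    by (simp add: exp_add distrib_left sum_distrib_left exp_sum del: inar_Y.simps)
qed

text \<open>The event and the finitely many phases before s form the factor F. These phases vanish
  as n grows and the powers of Q have a limit free of the state at time s, so the expectation
  factorises in the limit.\<close>

lemma expectation_iexp_limit:
  fixes B :: "nat \<Rightarrow> bool"
  shows "(\<lambda>n. expectation (\<lambda>x. of_bool (B (Y (s - 1) x)) * iexp (u / sqrt n * score n x + v / n * info n x)))
    \<longlonglongrightarrow> prob {x \<in> space M. B (Y (s - 1) x)} * exp (Complex (- (u^2 * V / 2)) (v * m\<^sub>2))"
proof -
  let ?e = "exp (Complex (- (u^2 * V / 2)) (v * m\<^sub>2))"
  define F where "F n l = of_bool (B (l ! (s - 1))) * iexp (\<Sum>k\<in>{1..<s}. phase u v n (l ! (k - 1)) (l ! k))"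
    for n l
  have F: "norm (F n l) \<le> 1" for n l by (simp add: F_def norm_mult)
  have F_hist: "F n (hist Y s x) = of_bool (B (Y (s - 1) x)) * iexp (\<Sum>k\<in>{1..<s}. phase u v n (Y (k - 1) x) (Y k x))" for n x
  proof -
    have "(\<Sum>k\<in>{1..<s}. phase u v n (hist Y s x ! (k - 1)) (hist Y s x ! k)) = (\<Sum>k\<in>{1..<s}. phase u v n (Y (k - 1) x) (Y k x))"
      by (intro sum.cong) (auto simp: nth_hist)
    then show ?thesis unfolding F_def by (simp only: nth_hist diff_le_self)
  qed
  have eq: "expectation (\<lambda>x. of_bool (B (Y (s - 1) x)) * iexp (u / sqrt n * score n x + v / n * info n x)) =
     expectation (\<lambda>x. F n (hist Y s x) * (Q u v n ^^ (n - s)) (\<lambda>_. 1) (Y s x))" if "s \<le> n" for n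
    unfolding iexp_score_info[OF that]
    using markov_iterated[where F="F n" and f="\<lambda>_. 1" and N="n - s" and u=u and v=v and n=n] F by (simp add: F_hist mult.assoc del: inar_Y.simps)
  have "(\<lambda>n. expectation (\<lambda>x. F n (hist Y s x) * (Q u v n ^^ (n - s)) (\<lambda>_. 1) (Y s x))) \<longlonglongrightarrow>
     expectation (\<lambda>x. (of_bool (B (Y (s - 1) x)) * 1) * ?e)"
  proof (rule integral_dominated_convergence[where w="\<lambda>_. 1"])
    show "(\<lambda>x. (of_bool (B (Y (s - 1) x)) * 1) * ?e) \<in> borel_measurable M"
      by (rule measurable_compose[OF measurable_Y, where g="\<lambda>y. (of_bool (B y) * 1) * ?e"]) simp
    have "(\<lambda>x. F n (hist Y s x)) \<in> borel_measurable M" for n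
      by (rule measurable_compose[OF measurable_hist_Y]) simp
    moreover have "(\<lambda>x. (Q u v n ^^ (n - s)) (\<lambda>_. 1) (Y s x)) \<in> borel_measurable M" for n
      by (rule measurable_compose[OF measurable_Y]) simp
    ultimately show "(\<lambda>x. F n (hist Y s x) * (Q u v n ^^ (n - s)) (\<lambda>_. 1) (Y s x)) \<in> borel_measurable M" for n
      by (intro borel_measurable_times)
    show "AE x in M. norm (F n (hist Y s x) * (Q u v n ^^ (n - s)) (\<lambda>_. 1) (Y s x)) \<le> 1" for n
      using F norm_Q_funpow_le[of "\<lambda>_. 1" 1] by (auto simp: norm_mult intro!: mult_le_one)
    show "AE x in M. (\<lambda>n. F n (hist Y s x) * (Q u v n ^^ (n - s)) (\<lambda>_. 1) (Y s x)) \<longlonglongrightarrow> (of_bool (B (Y (s - 1) x)) * 1) * ?e"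
    proof (intro AE_I2 tendsto_mult Q_funpow_limit)
      fix x
      have "(\<lambda>n. \<Sum>k\<in>{1..<s}. phase u v n (Y (k - 1) x) (Y k x)) \<longlonglongrightarrow> (\<Sum>k\<in>{1..<s}. 0)"
        by (intro tendsto_sum phase_tendsto_0)
      then have "(\<lambda>n. \<i> * complex_of_real (\<Sum>k\<in>{1..<s}. phase u v n (Y (k - 1) x) (Y k x))) \<longlonglongrightarrow> \<i> * complex_of_real 0"
        by (intro tendsto_mult tendsto_const tendsto_of_real) simp
      from tendsto_exp[OF this]
      have "(\<lambda>n. iexp (\<Sum>k\<in>{1..<s}. phase u v n (Y (k - 1) x) (Y k x))) \<longlonglongrightarrow> 1" by simp
      then show "(\<lambda>n. F n (hist Y s x)) \<longlonglongrightarrow> of_bool (B (Y (s - 1) x)) * 1"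
        unfolding F_hist by (intro tendsto_mult tendsto_const)
    qed
  qed simp
  moreover have "expectation (\<lambda>x. (of_bool (B (Y (s - 1) x)) * 1) * ?e) = prob {x \<in> space M. B (Y (s - 1) x)} * ?e"
  proof -
    have "expectation (\<lambda>x. of_bool (B (Y (s - 1) x)) :: complex) =
      expectation (\<lambda>x. complex_of_real (indicator {x \<in> space M. B (Y (s - 1) x)} x))"
      by (intro Bochner_Integration.integral_cong) (auto simp: indicator_def)
    also have "\<dots> = prob {x \<in> space M. B (Y (s - 1) x)}"
      unfolding integral_complex_of_real by simp
    finally show ?thesis by simp
  qed
  ultimately have "(\<lambda>n. expectation (\<lambda>x. F n (hist Y s x) * (Q u v n ^^ (n - s)) (\<lambda>_. 1) (Y s x))) \<longlonglongrightarrow>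
     prob {x \<in> space M. B (Y (s - 1) x)} * ?e" by simp
  then show ?thesis
    by (rule Lim_transform_eventually) (rule eventually_sequentiallyI[of s], simp only: eq)
qed

text \<open>u = t and v = - t a turn the joint characteristic function into that of one linear
  combination, and Levy's continuity theorem applies.\<close>

lemma weak_conv_score_info:
  fixes B :: "nat \<Rightarrow> bool" and a :: real
  defines "A \<equiv> {x \<in> space M. B (Y (s - 1) x)}"
  assumes A: "0 < prob A"
  shows "weak_conv_m (\<lambda>n. distr (uniform_measure M A) borel (\<lambda>x. score n x / sqrt n - a * (info n x / n)))
    (distr std_normal_distribution borel (\<lambda>z. sqrt V * z + (- a * m\<^sub>2)))"
proof (rule levy_continuity)
  have A_sets: "A \<in> sets M"
    unfolding A_def using measurable_sets[OF measurable_Y, of "{y. B y}" "s - 1"] by (simp add: vimage_def Int_def conj_commute)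
  interpret N: prob_space "uniform_measure M A"
    using A by (intro prob_space_uniform_measure) (auto simp: emeasure_eq_measure)
  show "real_distribution (distr (uniform_measure M A) borel (\<lambda>x. score n x / sqrt n - a * (info n x / n)))" for n
    by (rule N.real_distribution_distr) simp
  show "real_distribution (distr std_normal_distribution borel (\<lambda>z. sqrt V * z + (- a * m\<^sub>2)))"
    by (rule real_distribution_affine_normal)
  fix t
  have V: "0 \<le> V" unfolding V_def m\<^sub>2_def m\<^sub>3_def using \<alpha> \<sigma>\<^sub>2_nonneg by simp
  have eq: "char (distr (uniform_measure M A) borel (\<lambda>x. score n x / sqrt n - a * (info n x / n))) t =
    expectation (\<lambda>x. of_bool (B (Y (s - 1) x)) * iexp (t / sqrt n * score n x + (- (t * a)) / n * info n x)) / prob A" for n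
  proof -
    have "char (distr (uniform_measure M A) borel (\<lambda>x. score n x / sqrt n - a * (info n x / n))) t =
      integral\<^sup>L (uniform_measure M A) (\<lambda>x. iexp (t * (score n x / sqrt n - a * (info n x / n))))"
      unfolding char_def by (subst integral_distr) auto
    also have "\<dots> = expectation (\<lambda>x. indicator A x * iexp (t * (score n x / sqrt n - a * (info n x / n)))) / prob A"
      by (rule integral_uniform_measure[OF prob_space_axioms A_sets A]) simp
    also have "expectation (\<lambda>x. indicator A x * iexp (t * (score n x / sqrt n - a * (info n x / n)))) =
      expectation (\<lambda>x. of_bool (B (Y (s - 1) x)) * iexp (t / sqrt n * score n x + (- (t * a)) / n * info n x))"
      by (intro Bochner_Integration.integral_cong) (auto simp: A_def indicator_def algebra_simps)
    finally show ?thesis .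
  qed
  have "(\<lambda>n. expectation (\<lambda>x. of_bool (B (Y (s - 1) x)) * iexp (t / sqrt n * score n x + (- (t * a)) / n * info n x)) / prob A)
    \<longlonglongrightarrow> prob A * exp (Complex (- (t^2 * V / 2)) (- (t * a) * m\<^sub>2)) / prob A"
    using A unfolding A_def by (intro tendsto_divide tendsto_const expectation_iexp_limit) auto
  then show "(\<lambda>n. char (distr (uniform_measure M A) borel (\<lambda>x. score n x / sqrt n - a * (info n x / n))) t) \<longlonglongrightarrow>
    char (distr std_normal_distribution borel (\<lambda>z. sqrt V * z + (- a * m\<^sub>2))) t"
    unfolding eq char_affine_normal using A V by (simp add: mult.assoc)
qed

text \<open>For n large, the rescaled estimation error is at most a iff score/sqrt n - a * info/n <= 0;
  the convergence of that linear combination replaces an application of Slutsky's lemma.\<close>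

lemma weak_conv_cls_alpha:
  fixes B :: "nat \<Rightarrow> bool"
  defines "A \<equiv> {x \<in> space M. B (Y (s - 1) x)}"
  assumes A: "0 < prob A" and nondeg: "measure_pmf.prob pe {n. n \<noteq> 0} > 0"
  shows "weak_conv_m (\<lambda>n. distr (uniform_measure M A) borel (\<lambda>x. sqrt n * (cls_alpha s \<mu> Y n x - \<alpha>)))
    (normal_law (inar_sigma2 \<alpha> pe))"
  unfolding weak_conv_m_def weak_conv_def
proof (intro allI impI)
  fix a
  note pos = stationary_moments_pos[OF nondeg]
  let ?N = "uniform_measure M A" and ?W = "\<lambda>n x. score n x / sqrt n - a * (info n x / n)"
  let ?L = "distr std_normal_distribution borel (\<lambda>z. sqrt V * z + (- a * m\<^sub>2))"
  interpret L: real_distribution ?L by (rule real_distribution_affine_normal)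
  \<comment> \<open>Since V > 0 the limit law has no atoms, so 0 is a continuity point.\<close>
  have "measure ?L {0} = measure std_normal_distribution {a * m\<^sub>2 / sqrt V}"
    using pos by (subst measure_distr) (auto intro!: arg_cong[where f="measure std_normal_distribution"] simp: field_simps)
  then have "isCont (cdf ?L) 0"
    by (simp only: L.isCont_cdf std_normal_singleton)
  then have lim: "(\<lambda>n. cdf (distr ?N borel (?W n)) 0) \<longlonglongrightarrow> cdf ?L 0"
    using weak_conv_score_info[of B a] A unfolding A_def weak_conv_m_def weak_conv_def by blast
  \<comment> \<open>A normal variable with mean \<open>- a * m\<^sub>2\<close> and variance V is <=
    0 as often as a centred one with variance \<open>V / m\<^sub>2^2\<close> is <= a.\<close>
  have "cdf ?L 0 = measure std_normal_distribution {z. z \<le> a * m\<^sub>2 / sqrt V}"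
    using pos by (subst cdf_distr) (auto intro!: arg_cong[where f="measure std_normal_distribution"] simp: field_simps)
  also have "\<dots> = cdf (distr std_normal_distribution borel (\<lambda>z. sqrt (V / m\<^sub>2^2) * z)) a"
    using pos by (subst cdf_distr) (auto intro!: arg_cong[where f="measure std_normal_distribution"] simp: field_simps real_sqrt_divide)
  also have "\<dots> = cdf (normal_law (inar_sigma2 \<alpha> pe)) a"
    using pos by (subst normal_law_eq_distr) (auto simp: inar_sigma2_eq)
  finally have lim_eq: "cdf ?L 0 = cdf (normal_law (inar_sigma2 \<alpha> pe)) a" .
  have "filterlim (\<lambda>n. \<alpha> * sqrt (real n)) at_top sequentially"
    using \<alpha> by (intro filterlim_tendsto_pos_mult_at_top[OF tendsto_const] filterlim_compose[OF sqrt_at_top filterlim_real_sequentially])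
  then have ev: "\<forall>\<^sub>F n in sequentially. - a \<le> \<alpha> * sqrt (real n) \<and> 0 < n"
    by (auto simp: filterlim_at_top intro!: eventually_conj eventually_gt_at_top)
  show "(\<lambda>n. cdf (distr ?N borel (\<lambda>x. sqrt n * (cls_alpha s \<mu> Y n x - \<alpha>))) a) \<longlonglongrightarrow> cdf (normal_law (inar_sigma2 \<alpha> pe)) a"
    unfolding lim_eq[symmetric]
  proof (rule Lim_transform_eventually[OF lim], rule eventually_mono[OF ev])
    fix n assume n: "- a \<le> \<alpha> * sqrt (real n) \<and> 0 < n"
    have "?W n x \<le> 0 \<longleftrightarrow> sqrt n * (cls_alpha s \<mu> Y n x - \<alpha>) \<le> a" for x
    proof (cases "info n x = 0")
      case True
      \<comment> \<open>Zero information forces zero score, so one side reads 0 <= 0. The estimator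
        takes its default 0, and the error - \<alpha> sqrt n is <= a for the n considered.\<close>
      then show ?thesis using n info_eq_0[OF True] by (simp add: cls_alpha_eq mult.commute)
    next
      case False
      then have i: "0 < info n x" using info_nonneg[of n x] by simp
      have sq: "real n = sqrt n * sqrt n" by simp
      have "?W n x \<le> 0 \<longleftrightarrow> score n x / sqrt n \<le> a * info n x / (sqrt n * sqrt n)" by (simp flip: sq)
      also have "\<dots> \<longleftrightarrow> sqrt n * score n x \<le> a * info n x"
      proof -
        have *: "b / r \<le> c / (r * r) \<longleftrightarrow> r * b \<le> c" if "0 < r" for b c r :: real
          using that by (simp add: field_simps)
        show ?thesis by (rule *) (use n in simp)
      qed
      also have "\<dots> \<longleftrightarrow> sqrt n * (cls_alpha s \<mu> Y n x - \<alpha>) \<le> a"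
        using i by (simp add: cls_alpha_eq field_simps)
      finally show ?thesis .
    qed
    then show "cdf (distr ?N borel (?W n)) 0 = cdf (distr ?N borel (\<lambda>x. sqrt n * (cls_alpha s \<mu> Y n x - \<alpha>))) a"
      by (subst (1 2) cdf_distr) auto
  qed
qed

text \<open>The error of the outlier size is minus the state at time s - 1 times the error of the
  thinning estimate; on the conditioning event that factor is the constant - m.\<close>

lemma weak_conv_cls_theta:
  fixes m :: nat
  defines "A \<equiv> {x \<in> space M. Y (s - 1) x = m}"
  assumes A: "0 < prob A" and nondeg: "measure_pmf.prob pe {n. n \<noteq> 0} > 0"
  shows "weak_conv_m (\<lambda>n. distr (uniform_measure M A) borel
      (\<lambda>x. sqrt n * (cls_theta s \<mu> Y n x - (real (Y s x) - \<alpha> * real (Y (s - 1) x) - \<mu>))))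
    (normal_law (real m ^ 2 * inar_sigma2 \<alpha> pe))"
proof -
  let ?N = "uniform_measure M A" and ?Z = "\<lambda>n x. sqrt n * (cls_alpha s \<mu> Y n x - \<alpha>)"
  let ?T = "\<lambda>n x. sqrt n * (cls_theta s \<mu> Y n x - (real (Y s x) - \<alpha> * real (Y (s - 1) x) - \<mu>))"
  note pos = stationary_moments_pos[OF nondeg]
  have \<sigma>: "0 \<le> inar_sigma2 \<alpha> pe" using pos by (simp add: inar_sigma2_eq)
  have A_sets: "A \<in> sets M"
    unfolding A_def using measurable_sets[OF measurable_Y, of "{m}" "s - 1"] by (simp add: vimage_def Int_def conj_commute)
  interpret N: prob_space ?N
    using A by (intro prob_space_uniform_measure) (auto simp: emeasure_eq_measure)
  have T: "?T n x = - ?Z n x * real (Y (s - 1) x)" for n x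
    by (simp add: cls_theta_def algebra_simps)
  have ae: "AE x in ?N. Y (s - 1) x = m"
    by (rule AE_uniform_measureI[OF A_sets]) (auto simp: A_def)
  have distr_eq: "distr ?N borel (?T n) = distr ?N borel (\<lambda>x. - ?Z n x * real m)" for n
    unfolding T
  proof (rule distr_cong_AE)
    show "AE x in ?N. - ?Z n x * real (Y (s - 1) x) = - ?Z n x * real m"
      using ae by eventually_elim simp
  qed auto
  have Z: "weak_conv_m (\<lambda>n. distr ?N borel (?Z n)) (normal_law (inar_sigma2 \<alpha> pe))"
    using weak_conv_cls_alpha[of "\<lambda>y. y = m"] A nondeg unfolding A_def by blast
  have rd: "real_distribution (normal_law v)" if "0 \<le> v" for v
    using real_distribution_affine_normal[of "sqrt v" 0] that by (simp add: normal_law_eq_distr)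
  have ch: "char (normal_law v) t = exp (Complex (- (t^2 * v / 2)) 0)" if "0 \<le> v" for v t
    using char_affine_normal[of "sqrt v" 0 t] that by (simp add: normal_law_eq_distr)
  \<comment> \<open>Multiplying by - m evaluates the characteristic function at - m t, which treats
    m = 0 along with the other values.\<close>
  have "(\<lambda>n. char (distr ?N borel (?Z n)) (- real m * t)) \<longlonglongrightarrow> char (normal_law (inar_sigma2 \<alpha> pe)) (- real m * t)" for t
    by (rule levy_continuity1[OF N.real_distribution_distr rd[OF \<sigma>] Z]) simp
  moreover have "char (distr ?N borel (?T n)) t = char (distr ?N borel (?Z n)) (- real m * t)" for n t
    unfolding distr_eq char_def by (subst (1 2) integral_distr) (auto simp: algebra_simps)
  moreover have "char (normal_law (real m ^ 2 * inar_sigma2 \<alpha> pe)) t = char (normal_law (inar_sigma2 \<alpha> pe)) (- real m * t)" for t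
    using \<sigma> by (simp add: ch power_mult_distrib mult_ac)
  ultimately have "(\<lambda>n. char (distr ?N borel (?T n)) t) \<longlonglongrightarrow> char (normal_law (real m ^ 2 * inar_sigma2 \<alpha> pe)) t" for t
    by (simp only:)
  moreover have "real_distribution (distr ?N borel (?T n))" for n
    unfolding T by (rule N.real_distribution_distr) simp
  ultimately show ?thesis
    using \<sigma> by (intro levy_continuity rd) auto
qed

end

theorem theorem4p2p2:
  fixes M :: "'a measure"
    and \<alpha> :: real and pe :: "nat pmf"
    and xi :: "nat \<Rightarrow> nat \<Rightarrow> 'a \<Rightarrow> nat" and eps :: "nat \<Rightarrow> 'a \<Rightarrow> nat" and Y0 :: "'a \<Rightarrow> nat"
    and s \<theta> :: nat
  assumes "prob_space M"
    and "0 < \<alpha>" "\<alpha> < 1"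
    and "1 \<le> s" "1 \<le> \<theta>"
    and indep: "prob_space.indep_vars M (\<lambda>_. count_space UNIV) (inar_rv xi eps Y0) inar_indices"
    and eps_law: "\<And>k. 1 \<le> k \<Longrightarrow> distr M (count_space UNIV) (eps k) = measure_pmf pe"
    and xi_law: "\<And>k j. 1 \<le> k \<Longrightarrow> 1 \<le> j \<Longrightarrow>
                   distr M (count_space UNIV) (xi k j) = measure_pmf (map_pmf of_bool (bernoulli_pmf \<alpha>))"
    and "integrable (measure_pmf pe) (\<lambda>n. real n ^ 2)"
    and "measure_pmf.prob pe {n. n \<noteq> 0} > 0"
    and "integrable (measure_pmf pe) (\<lambda>n. real n ^ 3)"
    and "integrable M (\<lambda>x. real (Y0 x) ^ 3)"
  shows "weak_conv_m
           (\<lambda>n. distr M borel (\<lambda>x. sqrt (real n) *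
              (cls_alpha s (measure_pmf.expectation pe real) (inar_Y s \<theta> xi eps Y0) n x - \<alpha>)))
           (normal_law (inar_sigma2 \<alpha> pe))
         \<and> (\<forall>m. measure M {x \<in> space M. inar_Y s \<theta> xi eps Y0 (s - 1) x = m} > 0 \<longrightarrow>
           weak_conv_m
             (\<lambda>n. distr (uniform_measure M {x \<in> space M. inar_Y s \<theta> xi eps Y0 (s - 1) x = m}) borel
                (\<lambda>x. sqrt (real n) *
                   (cls_theta s (measure_pmf.expectation pe real) (inar_Y s \<theta> xi eps Y0) n x
                    - (real (inar_Y s \<theta> xi eps Y0 s x) - \<alpha> * real (inar_Y s \<theta> xi eps Y0 (s - 1) x)
                       - measure_pmf.expectation pe real))))
             (normal_law (real m ^ 2 * inar_sigma2 \<alpha> pe)))"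
proof -
  interpret prob_space M by fact
  interpret inar_path \<alpha> pe M xi eps Y0 s \<theta>
    using assms by unfold_locales auto
  \<comment> \<open>The unconditional claim is conditioning on the whole space.\<close>
  have "uniform_measure M (space M) = M"
    by (rule measure_eqI) (auto simp: emeasure_space_1 emeasure_uniform_measure Int_absorb1 sets.sets_into_space divide_ennreal_def)
  then have "weak_conv_m (\<lambda>n. distr M borel (\<lambda>x. sqrt n * (cls_alpha s \<mu> Y n x - \<alpha>))) (normal_law (inar_sigma2 \<alpha> pe))"
    using weak_conv_cls_alpha[of "\<lambda>_. True"] assms(10) by (simp add: prob_space)
  then show ?thesis
    using weak_conv_cls_theta assms(10) unfolding \<mu>_def by blast
qed

end
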